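(* Let $X$ be a separated locally convex topological vector space. Let $m\in\mathbb{N}$, and let $f_i:X\to\left]-\infty,+\infty\right]$ be proper and convex for each $i\in\{1,2,\ldots,m\}$, with $\bigcap_{i=1}^{m}\operatorname{dom} f_i\neq\varnothing$. Suppose that, for every $i\in\{1,\ldots,m\}$, $\overline{f_i}=f_i$ on $\bigcap_{j=1}^{m}\operatorname{dom}\overline{f_j}$. Assume that any one of the following conditions holds. (i) There exists $K>0$ such that for every $x\in \bigcap_{i=1}^{m}\operatorname{dom} f_i$ and every $\varepsilon>0$, $$\overline{\left[\sum_{i=1}^{m}\partial_\varepsilon f_i(x)\right]}^{\mathrm{w*}}\subseteq\sum_{i=1}^{m}\partial_{K\varepsilon} f_i(x).$$ (ii) $\left(\sum_{i=1}^m f_i\right)^*=f_1^*\Box\cdots \Box f_m^*$ in $X^*$. (iii) $f_1^*\Box\cdots \Box f_m^*$ is weak$^*$ lower semicontinuous. (iv) For every $x\in X$ and every $\varepsilon\geq0$, $$\partial_{\varepsilon}(f_1+\cdots+f_m)(x)= \bigcap_{\eta>0} \left[ \bigcup_{\varepsilon_i\geq0,\ \sum_{i=1}^m\varepsilon_i=\varepsilon+\eta}\Big(\partial_{\varepsilon_1} f_1(x)+\cdots+\partial_{\varepsilon_m} f_m(x)\Big)\right].$$ Then for every $x\in X$, $$\partial(f_1+\cdots+f_m)(x)= \bigcap_{\eta>0} \left[ \partial_{\eta} f_1(x)+\cdots+\partial_{\eta} f_m(x)\right].$$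
   Context: $X$ is a separated (Hausdorff) locally convex topological vector space and $X^*$ is its continuous dual endowed with the weak$^*$ topology $\omega(X^*,X)$; $\overline{D}^{\mathrm{w*}}$ is the weak$^*$ closure of $D\subseteq X^*$. Sums of sets are Minkowski sums. For $f:X\to[-\infty,+\infty]$: $\operatorname{dom} f=\{x: f(x)<+\infty\}$; $f$ is proper if $\operatorname{dom} f\neq\varnothing$ and $f>-\infty$ everywhere; $\overline{f}$ is the lower semicontinuous hull of $f$ (it may take the value $-\infty$); the Fenchel conjugate is $f^*:X^*\to[-\infty,+\infty]$, $f^*(x^* )=\sup_{x\in X}\{\langle x,x^*\rangle-f(x)\}$. For $\varepsilon\ge0$, $\partial_\varepsilon f(x)=\{x^*\in X^*: \langle y-x,x^*\rangle+f(x)\le f(y)+\varepsilon\ \ \forall y\in X\}$ if $f(x)\in\mathbb{R}$, and $\partial_\varepsilon f(x)=\varnothing$ otherwise; $\partial f=\partial_0 f$. The infimal convolution is $(f_1^*\Box\cdots\Box f_m^* )(z^* )=\inf\{f_1^*(z_1^* )+\cdots+f_m^*(z_m^* ): z_1^*+\cdots+z_m^*=z^*\}$. *)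

theory Defs
  imports
    "HOL-Analysis.Analysis"
    "HOL-Library.Function_Algebras"
    "HOL-Library.Set_Algebras"
begin

section \<open>Separated locally convex spaces and the weak* topology\<close>

class locally_convex_space = real_vector + t2_space + topological_ab_group_add +
  assumes tendsto_scaleR_Pair:
    "LIM p (nhds c \<times>\<^sub>F nhds a). fst p *\<^sub>R snd p :> nhds (c *\<^sub>R a)"
  and locally_convex:
    "open U \<Longrightarrow> 0 \<in> U \<Longrightarrow> \<exists>V. open V \<and>
       (\<forall>x\<in>V. \<forall>y\<in>V. \<forall>u\<ge>0. \<forall>v\<ge>0. u + v = 1 \<longrightarrow> u *\<^sub>R x + v *\<^sub>R y \<in> V) \<and>
       0 \<in> V \<and> V \<subseteq> U" \<comment> \<open>the unfolded \<open>convex V\<close>, whose sort constraint a class body does not admit\<close>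

lemma ex_convex_nhd:
  fixes U :: "'a::locally_convex_space set"
  assumes "open U" "0 \<in> U"
  shows "\<exists>V. open V \<and> convex V \<and> 0 \<in> V \<and> V \<subseteq> U"
  using locally_convex[OF assms] unfolding convex_def by blast

instance real_normed_vector \<subseteq> locally_convex_space
proof
  show "LIM p (nhds c \<times>\<^sub>F nhds a). fst p *\<^sub>R snd p :> nhds (c *\<^sub>R a)" for c :: real and a :: 'a
    by (intro tendsto_scaleR filterlim_fst filterlim_snd)
  fix U :: "'a set"
  assume "open U" "0 \<in> U"
  then obtain e where "e > 0" "ball 0 e \<subseteq> U"
    by (meson open_contains_ball)
  then have "open (ball (0::'a) e) \<and> convex (ball (0::'a) e) \<and> (0::'a) \<in> ball 0 e \<and> ball 0 e \<subseteq> U"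
    by simp
  then show "\<exists>V. open V \<and>
       (\<forall>x\<in>V. \<forall>y\<in>V. \<forall>u\<ge>0. \<forall>v\<ge>0. u + v = 1 \<longrightarrow> u *\<^sub>R x + v *\<^sub>R y \<in> V) \<and>
       0 \<in> V \<and> V \<subseteq> U"
    unfolding convex_def by blast
qed

definition continuous_dual :: "('a::locally_convex_space \<Rightarrow> real) set" where
  "continuous_dual = {\<phi>. linear \<phi> \<and> continuous_on UNIV \<phi>}"

text \<open>The weak* topology is the topology of pointwise convergence on the dual.\<close>

definition weak_star :: "('a::locally_convex_space \<Rightarrow> real) topology" where
  "weak_star = subtopology (powertop_real UNIV) continuous_dual"


section \<open>Extended-real-valued functions\<close>

definition effective_domain :: "('a \<Rightarrow> ereal) \<Rightarrow> 'a set" where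
  "effective_domain f = {x. f x < \<infinity>}"

definition proper_fun :: "('a \<Rightarrow> ereal) \<Rightarrow> bool" where
  "proper_fun f \<longleftrightarrow> effective_domain f \<noteq> {} \<and> (\<forall>x. f x > -\<infinity>)"

definition convex_fun :: "('a::real_vector \<Rightarrow> ereal) \<Rightarrow> bool" where
  "convex_fun f \<longleftrightarrow> (\<forall>x y. \<forall>t\<in>{0<..<1}.
     f ((1 - t) *\<^sub>R x + t *\<^sub>R y) \<le> ereal (1 - t) * f x + ereal t * f y)"

definition lower_semicontinuous_map :: "'a topology \<Rightarrow> ('a \<Rightarrow> ereal) \<Rightarrow> bool" where
  "lower_semicontinuous_map T g \<longleftrightarrow> (\<forall>c. closedin T {x \<in> topspace T. g x \<le> c})"

text \<open>The greatest lower semicontinuous minorant.\<close>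

definition lsc_hull :: "('a::topological_space \<Rightarrow> ereal) \<Rightarrow> 'a \<Rightarrow> ereal" where
  "lsc_hull f x = (SUP g\<in>{g. lower_semicontinuous_map euclidean g \<and> g \<le> f}. g x)"

text \<open>The next two functions are meaningful for arguments in \<open>continuous_dual\<close> only.\<close>

definition fenchel_conjugate ::
    "('a::locally_convex_space \<Rightarrow> ereal) \<Rightarrow> ('a \<Rightarrow> real) \<Rightarrow> ereal" where
  "fenchel_conjugate f \<phi> = (SUP x. ereal (\<phi> x) - f x)"

definition infimal_convolution ::
    "'i set \<Rightarrow> ('i \<Rightarrow> ('a::locally_convex_space \<Rightarrow> real) \<Rightarrow> ereal) \<Rightarrow> ('a \<Rightarrow> real) \<Rightarrow> ereal" where
  "infimal_convolution I g \<phi> =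
     (INF z\<in>{z. (\<forall>i\<in>I. z i \<in> continuous_dual) \<and> (\<Sum>i\<in>I. z i) = \<phi>}. \<Sum>i\<in>I. g i (z i))"

definition eps_subdifferential ::
    "real \<Rightarrow> ('a::locally_convex_space \<Rightarrow> ereal) \<Rightarrow> 'a \<Rightarrow> ('a \<Rightarrow> real) set" where
  "eps_subdifferential \<epsilon> f x =
     (if \<bar>f x\<bar> \<noteq> \<infinity>
      then {\<phi> \<in> continuous_dual. \<forall>y. ereal (\<phi> (y - x)) + f x \<le> f y + ereal \<epsilon>}
      else {})"

abbreviation subdifferential ::
    "('a::locally_convex_space \<Rightarrow> ereal) \<Rightarrow> 'a \<Rightarrow> ('a \<Rightarrow> real) set" where
  "subdifferential \<equiv> eps_subdifferential 0"

end

theory Submission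
  imports Defs
begin

text \<open>Everything reduces to the inclusion of \<open>\<partial>(\<Sum> f\<^sub>i)(x)\<close> in the weak* closure of
  \<open>\<Sum> \<partial>\<^sub>\<epsilon> f\<^sub>i(x)\<close> for every \<open>\<epsilon> > 0\<close>. If \<open>\<phi>\<close> lay outside this closure, a vector \<open>y\<close> would
  separate it strictly; the support function of \<open>\<partial>\<^sub>\<epsilon> f\<^sub>i(x)\<close> at \<open>y\<close> is the infimum over \<open>t > 0\<close> of
  \<open>(h\<^sub>i(x + t y) - f\<^sub>i(x) + \<epsilon>) / t\<close> with \<open>h\<^sub>i\<close> the lower semicontinuous hull of \<open>f\<^sub>i\<close>, which bounds the
  directional derivative of the sum by less than \<open>\<phi>(y)\<close>. Given this, condition (i) absorbs
  the closure, and condition (iii) yields that the infimal convolution at \<open>\<phi>\<close> is at most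
  \<open>\<phi>(x) - \<Sum> f\<^sub>i(x)\<close>, as (ii) does. A decomposition of \<open>\<phi>\<close> that is \<open>\<eta>\<close>-optimal in the infimal
  convolution consists of \<open>\<eta>\<close>-subgradients, because every Fenchel-Young gap is nonnegative.\<close>

section \<open>Separation\<close>

text \<open>A maximal convex cone \<open>P\<close>
  containing \<open>C\<close> but not \<open>- c\<close> is a total preorder with order unit \<open>c\<close>, and
  \<open>L v = Sup {s. v - s c \<in> P}\<close> is linear.\<close>

lemma convex_absorbing_separation:
  fixes C :: "'a::real_vector set"
  assumes "convex C" "0 \<notin> C" and absorbing: "\<And>v. \<exists>t>0. c + t *\<^sub>R v \<in> C"
  obtains L :: "'a \<Rightarrow> real" where "linear L" "\<And>v. v \<in> C \<Longrightarrow> 0 \<le> L v" "L c = 1"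
proof -
  define cones where "cones = {P. C \<subseteq> P \<and> - c \<notin> P \<and> (\<forall>x\<in>P. \<forall>y\<in>P. x + y \<in> P) \<and>
    (\<forall>x\<in>P. \<forall>a\<ge>0. a *\<^sub>R x \<in> P)}"
  have cC: "c \<in> C"
    using absorbing[of 0] by simp
  \<comment> \<open>The cone generated by \<open>C\<close> starts the Zorn argument. If it contained
    \<open>- c\<close> as \<open>a\<close> times some \<open>x\<close> in \<open>C\<close>, the
    weights \<open>1 / (1 + a)\<close> and \<open>a / (1 + a)\<close> would exhibit 0 as a convex
    combination of \<open>c\<close> and \<open>x\<close>.\<close>
  define P0 where "P0 = {a *\<^sub>R x | a x. 0 \<le> a \<and> x \<in> C}"
  have "P0 \<in> cones"
  proof -
    have 1: "C \<subseteq> P0"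
      unfolding P0_def using zero_le_one scaleR_one by (metis (mono_tags, lifting) mem_Collect_eq subsetI)
    have 2: "- c \<notin> P0"
    proof
      assume "- c \<in> P0"
      then obtain a x where a: "0 \<le> a" "x \<in> C" "- c = a *\<^sub>R x"
        unfolding P0_def by blast
      have "(1 / (1 + a)) *\<^sub>R c + (a / (1 + a)) *\<^sub>R x \<in> C"
        using a cC by (intro convexD[OF \<open>convex C\<close>]) (auto simp: add_divide_distrib[symmetric])
      moreover have "(1 / (1 + a)) *\<^sub>R c + (a / (1 + a)) *\<^sub>R x = (1 / (1 + a)) *\<^sub>R (c + a *\<^sub>R x)"
        by (simp add: scaleR_add_right)
      ultimately show False
        using a(3) \<open>0 \<notin> C\<close> by (metis add.right_inverse scaleR_zero_right)
    qed
    have 3: "u + v \<in> P0" if uv: "u \<in> P0" "v \<in> P0" for u v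
    proof -
      obtain a x where a: "0 \<le> a" "x \<in> C" "u = a *\<^sub>R x"
        using uv unfolding P0_def by blast
      obtain b y where b: "0 \<le> b" "y \<in> C" "v = b *\<^sub>R y"
        using uv unfolding P0_def by blast
      show ?thesis
      proof (cases "a + b = 0")
        case True
        then have "a = 0" "b = 0" using a b by auto
        then show ?thesis using a(3) b(3) uv by simp
      next
        case False
        have "(a / (a + b)) *\<^sub>R x + (b / (a + b)) *\<^sub>R y \<in> C"
          using a b False by (intro convexD[OF \<open>convex C\<close>]) (auto simp: add_divide_distrib[symmetric])
        moreover have "u + v = (a + b) *\<^sub>R ((a / (a + b)) *\<^sub>R x + (b / (a + b)) *\<^sub>R y)"
          using False a b by (simp add: scaleR_add_right)
        ultimately show ?thesis
          unfolding P0_def using a(1) b(1) add_nonneg_nonneg by blast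
      qed
    qed
    have 4: "a *\<^sub>R u \<in> P0" if "u \<in> P0" "0 \<le> a" for a u
      using that unfolding P0_def by (smt (verit) mem_Collect_eq mult_nonneg_nonneg scaleR_scaleR)
    show ?thesis unfolding cones_def using 1 2 3 4 by blast
  qed
  have "\<exists>P\<in>cones. \<forall>X\<in>cones. P \<subseteq> X \<longrightarrow> X = P"
  proof (rule subset_Zorn_nonempty)
    show "cones \<noteq> {}" using \<open>P0 \<in> cones\<close> by blast
    fix \<C> assume C: "\<C> \<noteq> {}" "subset.chain cones \<C>"
    have sub: "\<And>P. P \<in> \<C> \<Longrightarrow> P \<in> cones"
      and lin: "\<And>P Q. P \<in> \<C> \<Longrightarrow> Q \<in> \<C> \<Longrightarrow> P \<subseteq> Q \<or> Q \<subseteq> P"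
      using C(2) by (auto simp: subset_chain_def)
    have "x + y \<in> \<Union>\<C>" if xy: "x \<in> \<Union>\<C>" "y \<in> \<Union>\<C>" for x y
    proof -
      obtain P Q where PQ: "P \<in> \<C>" "x \<in> P" "Q \<in> \<C>" "y \<in> Q" using xy by blast
      then obtain R where "R \<in> \<C>" "x \<in> R" "y \<in> R" using lin by blast
      then show ?thesis using sub unfolding cones_def by blast
    qed
    moreover have "C \<subseteq> \<Union>\<C>"
      using sub C(1) unfolding cones_def by fast
    moreover have "- c \<notin> \<Union>\<C>"
      using sub unfolding cones_def by fast
    moreover have "a *\<^sub>R x \<in> \<Union>\<C>" if "x \<in> \<Union>\<C>" "0 \<le> a" for x a
      using sub that unfolding cones_def by fast
    ultimately show "\<Union>\<C> \<in> cones"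
      unfolding cones_def by simp
  qed
  then obtain P where "P \<in> cones" and max: "\<And>Q. Q \<in> cones \<Longrightarrow> P \<subseteq> Q \<Longrightarrow> Q = P"
    by blast
  then have CP: "C \<subseteq> P" and nc: "- c \<notin> P" and add: "\<And>x y. x \<in> P \<Longrightarrow> y \<in> P \<Longrightarrow> x + y \<in> P"
    and scale: "\<And>a x. x \<in> P \<Longrightarrow> 0 \<le> a \<Longrightarrow> a *\<^sub>R x \<in> P"
    unfolding cones_def by blast+
  have cP: "c \<in> P" using cC CP by blast
  have zP: "0 \<in> P" using scale[OF cP, of 0] by simp
  \<comment> \<open>By maximality, adjoining the ray through \<open>v\<close> must violate a
    condition of \<open>cones\<close>. Only the exclusion of \<open>- c\<close> can fail, and the
    coefficient of \<open>v\<close> is then positive because \<open>- c\<close> is not in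
    \<open>P\<close>.\<close>
  have extend: "\<exists>a>0. \<exists>p\<in>P. - c = p + a *\<^sub>R v" if "v \<notin> P" for v
  proof -
    define Q where "Q = {p + a *\<^sub>R v | p a. p \<in> P \<and> 0 \<le> a}"
    have PQ: "P \<subseteq> Q"
    proof
      fix p assume "p \<in> P"
      then have "p = p + 0 *\<^sub>R v \<and> p \<in> P \<and> (0::real) \<le> 0" by simp
      then show "p \<in> Q" unfolding Q_def by blast
    qed
    have "v = 0 + 1 *\<^sub>R v \<and> 0 \<in> P \<and> (0::real) \<le> 1" using zP by simp
    then have "v \<in> Q" unfolding Q_def by blast
    then have "Q \<notin> cones" using max PQ that by blast
    moreover have "x + y \<in> Q" if xy: "x \<in> Q" "y \<in> Q" for x y
    proof -
      obtain p a q b where "x = p + a *\<^sub>R v" "p \<in> P" "0 \<le> a" "y = q + b *\<^sub>R v" "q \<in> P" "0 \<le> b"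
        using xy unfolding Q_def by blast
      then have "x + y = (p + q) + (a + b) *\<^sub>R v \<and> p + q \<in> P \<and> 0 \<le> a + b"
        using add by (simp add: scaleR_add_left)
      then show ?thesis unfolding Q_def by blast
    qed
    moreover have "b *\<^sub>R x \<in> Q" if xb: "x \<in> Q" "0 \<le> b" for x b
    proof -
      obtain p a where "x = p + a *\<^sub>R v" "p \<in> P" "0 \<le> a"
        using xb unfolding Q_def by blast
      then have "b *\<^sub>R x = b *\<^sub>R p + (b * a) *\<^sub>R v \<and> b *\<^sub>R p \<in> P \<and> 0 \<le> b * a"
        using scale xb by (simp add: scaleR_add_right)
      then show ?thesis unfolding Q_def by blast
    qed
    ultimately have "- c \<in> Q" using PQ CP unfolding cones_def by blast
    then obtain p a where pa: "- c = p + a *\<^sub>R v" "p \<in> P" "0 \<le> a" unfolding Q_def by blast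
    moreover have "a \<noteq> 0" using pa nc by auto
    ultimately show ?thesis by (metis less_eq_real_def)
  qed
  have total: "v \<in> P \<or> - v \<in> P" for v
  proof (rule ccontr)
    assume "\<not> (v \<in> P \<or> - v \<in> P)"
    then obtain a p b q where ab: "0 < a" "p \<in> P" "- c = p + a *\<^sub>R v" "0 < b" "q \<in> P" "- c = q + b *\<^sub>R (- v)"
      using extend by metis
    \<comment> \<open>The weights \<open>b\<close> and \<open>a\<close> cancel \<open>v\<close>
      between the two representations of \<open>- c\<close>.\<close>
    have "(a + b) *\<^sub>R (- c) = b *\<^sub>R (- c) + a *\<^sub>R (- c)"
      by (simp only: scaleR_add_left add.commute)
    also have "\<dots> = b *\<^sub>R (p + a *\<^sub>R v) + a *\<^sub>R (q + b *\<^sub>R (- v))"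
      using ab(3,6) by metis
    also have "\<dots> = b *\<^sub>R p + a *\<^sub>R q" by (simp add: algebra_simps)
    finally have "(a + b) *\<^sub>R (- c) = b *\<^sub>R p + a *\<^sub>R q" .
    moreover have "b *\<^sub>R p + a *\<^sub>R q \<in> P" using ab by (intro add scale) auto
    ultimately have "(a + b) *\<^sub>R (- c) \<in> P" by (simp only:)
    then have "(1 / (a + b)) *\<^sub>R ((a + b) *\<^sub>R (- c)) \<in> P"
      by (rule scale) (use ab(1,4) in simp)
    moreover have "(1 / (a + b)) *\<^sub>R ((a + b) *\<^sub>R (- c)) = - c" using ab(1,4) by simp
    ultimately show False using nc by (simp only:)
  qed
  define L where "L v = Sup {s. v - s *\<^sub>R c \<in> P}" for v
  have down: "v - s' *\<^sub>R c \<in> P" if "v - s *\<^sub>R c \<in> P" "s' \<le> s" for v s s'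
    using add[OF that(1) scale[OF cP, of "s - s'"]] that(2) by (simp add: algebra_simps)
  have absP: "\<exists>k. v + k *\<^sub>R c \<in> P" for v
  proof -
    obtain t where t: "t > 0" "c + t *\<^sub>R v \<in> C" using absorbing by blast
    then have "(1 / t) *\<^sub>R (c + t *\<^sub>R v) \<in> P" using CP by (intro scale) auto
    moreover have "(1 / t) *\<^sub>R (c + t *\<^sub>R v) = v + (1 / t) *\<^sub>R c" using t by (simp add: algebra_simps)
    ultimately show ?thesis by metis
  qed
  have neg: "- (s *\<^sub>R c) \<notin> P" if "s > 0" for s
  proof
    assume "- (s *\<^sub>R c) \<in> P"
    from scale[OF this, of "1 / s"] show False using that nc by simp
  qed
  have ne: "{s. v - s *\<^sub>R c \<in> P} \<noteq> {}" for v
  proof -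
    obtain k where "v + k *\<^sub>R c \<in> P" using absP by blast
    then have "v - (- k) *\<^sub>R c \<in> P" by simp
    then show ?thesis by blast
  qed
  \<comment> \<open>Otherwise the two memberships add up to a negative multiple of \<open>c\<close>
    in \<open>P\<close>, which \<open>neg\<close> excludes. This makes the supremum
    \<open>L v\<close> finite.\<close>
  have cross: "s \<le> s'" if "v - s *\<^sub>R c \<in> P" "s' *\<^sub>R c - v \<in> P" for v s s'
  proof (rule ccontr)
    assume "\<not> s \<le> s'"
    then show False using add[OF that] neg[of "s - s'"] by (simp add: algebra_simps)
  qed
  have bdd: "bdd_above {s. v - s *\<^sub>R c \<in> P}" for v
  proof -
    obtain k where "- v + k *\<^sub>R c \<in> P" using absP by blast
    then show ?thesis using cross[of v _ k] by (intro bdd_aboveI[of _ k]) simp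
  qed
  \<comment> \<open>The boundary element, at \<open>s = L v\<close>, need not lie in
    \<open>P\<close>, so membership is claimed only strictly on either side. The proofs of
    additivity and homogeneity therefore carry a slack \<open>e\<close>.\<close>
  have below: "v - s *\<^sub>R c \<in> P" if "s < L v" for s v
    using less_cSupD[OF ne, of s v] that down[of v _ s] unfolding L_def by fastforce
  have above: "s *\<^sub>R c - v \<in> P" if "s > L v" for s v
  proof -
    have "v - s *\<^sub>R c \<notin> P"
      using cSup_upper[OF _ bdd, of s v] that unfolding L_def by fastforce
    then show ?thesis using total[of "v - s *\<^sub>R c"] by simp
  qed
  have LI: "s \<le> L v" if "v - s *\<^sub>R c \<in> P" for s v
    using cSup_upper[OF _ bdd, of s v] that unfolding L_def by simp
  have LU: "L v \<le> s" if "s *\<^sub>R c - v \<in> P" for s v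
    unfolding L_def using that cross by (intro cSup_least ne) blast
  have sub_add: "s + s' \<le> L (v + w)" if "s < L v" "s' < L w" for s s' v w
  proof -
    have "(v - s *\<^sub>R c) + (w - s' *\<^sub>R c) \<in> P" using that by (intro add below)
    also have "(v - s *\<^sub>R c) + (w - s' *\<^sub>R c) = (v + w) - (s + s') *\<^sub>R c" by (simp add: scaleR_add_left)
    finally show ?thesis by (rule LI)
  qed
  have super_add: "L (v + w) \<le> s + s'" if "L v < s" "L w < s'" for s s' v w
  proof -
    have "(s *\<^sub>R c - v) + (s' *\<^sub>R c - w) \<in> P" using that by (intro add above)
    also have "(s *\<^sub>R c - v) + (s' *\<^sub>R c - w) = (s + s') *\<^sub>R c - (v + w)" by (simp add: scaleR_add_left)
    finally show ?thesis by (rule LU)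
  qed
  have Ladd: "L (v + w) = L v + L w" for v w
  proof (rule antisym)
    show "L (v + w) \<le> L v + L w"
    proof (rule field_le_epsilon)
      fix e :: real assume "e > 0"
      then show "L (v + w) \<le> L v + L w + e"
        using super_add[of v "L v + e / 2" w "L w + e / 2"] by simp
    qed
    show "L v + L w \<le> L (v + w)"
    proof (rule field_le_epsilon)
      fix e :: real assume "e > 0"
      then show "L v + L w \<le> L (v + w) + e"
        using sub_add[of "L v - e / 2" v "L w - e / 2" w] by simp
    qed
  qed
  have L0: "L 0 = 0" using Ladd[of 0 0] by simp
  have Lneg: "L (- v) = - L v" for v using Ladd[of v "- v"] L0 by simp
  have Lpos: "L (a *\<^sub>R v) = a * L v" if "a > 0" for a v
  proof (rule antisym)
    show "L (a *\<^sub>R v) \<le> a * L v"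
    proof (rule field_le_epsilon)
      fix e :: real assume "e > 0"
      then have "a *\<^sub>R ((L v + e / a) *\<^sub>R c - v) \<in> P" using that by (intro scale above) auto
      then show "L (a *\<^sub>R v) \<le> a * L v + e"
        using that by (intro LU) (simp add: algebra_simps)
    qed
    show "a * L v \<le> L (a *\<^sub>R v)"
    proof (rule field_le_epsilon)
      fix e :: real assume "e > 0"
      then have "a *\<^sub>R (v - (L v - e / a) *\<^sub>R c) \<in> P" using that by (intro scale below) auto
      also have "a *\<^sub>R (v - (L v - e / a) *\<^sub>R c) = a *\<^sub>R v - (a * L v - e) *\<^sub>R c"
        using that by (simp add: algebra_simps)
      finally show "a * L v \<le> L (a *\<^sub>R v) + e" using LI by fastforce
    qed
  qed
  have Lscale: "L (a *\<^sub>R v) = a * L v" for a v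
  proof (cases a "0::real" rule: linorder_cases)
    case less
    then show ?thesis using Lpos[of "- a" v] Lneg[of "a *\<^sub>R v"] by simp
  qed (use L0 Lpos in auto)
  show thesis
  proof
    show "linear L" using Ladd Lscale by (intro linearI) auto
    show "0 \<le> L v" if "v \<in> C" for v using LI[of v 0] that CP by auto
    show "L c = 1" using LI[of c 1] LU[of 1 c] zP by simp
  qed
qed

section \<open>The vector space of functions and the weak* topology\<close>

instantiation "fun" :: (type, real_vector) real_vector
begin

text \<open>With pointwise addition this makes all functions, linear or not, a vector space. The
  separation below takes place there rather than in the dual.\<close>

definition scaleR_fun :: "real \<Rightarrow> ('a \<Rightarrow> 'b) \<Rightarrow> 'a \<Rightarrow> 'b" where
  "scaleR_fun c f = (\<lambda>x. c *\<^sub>R f x)"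

instance
proof
  fix a b :: real and f g :: "'a \<Rightarrow> 'b"
  show "a *\<^sub>R (f + g) = a *\<^sub>R f + a *\<^sub>R g"
    by (simp add: scaleR_fun_def fun_eq_iff scaleR_add_right)
  show "(a + b) *\<^sub>R f = a *\<^sub>R f + b *\<^sub>R f"
    by (simp add: scaleR_fun_def fun_eq_iff scaleR_add_left)
  show "a *\<^sub>R b *\<^sub>R f = (a * b) *\<^sub>R f"
    by (simp add: scaleR_fun_def fun_eq_iff)
  show "1 *\<^sub>R f = f"
    by (simp add: scaleR_fun_def fun_eq_iff)
qed

end

lemma sum_fun_apply: "(\<Sum>i\<in>I. f i) x = (\<Sum>i\<in>I. f i x)"
  for f :: "'i \<Rightarrow> 'a \<Rightarrow> 'b::comm_monoid_add"
  by (induction I rule: infinite_finite_induct) auto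

lemma topspace_weak_star [simp]: "topspace weak_star = continuous_dual"
  unfolding weak_star_def by simp

text \<open>An open set of the product topology restricts only finitely many coordinates, and the
  smallest of finitely many radii serves them all.\<close>

lemma openin_weak_star_imp_basic:
  fixes \<phi> :: "'a::locally_convex_space \<Rightarrow> real"
  assumes "openin weak_star T" "\<phi> \<in> T"
  obtains Y \<delta> where "finite Y" "\<delta> > 0"
    "\<And>\<psi>. \<psi> \<in> continuous_dual \<Longrightarrow> (\<And>k. k \<in> Y \<Longrightarrow> \<bar>\<psi> k - \<phi> k\<bar> < \<delta>) \<Longrightarrow> \<psi> \<in> T"
proof -
  obtain S where S: "openin (powertop_real UNIV) S" "T = S \<inter> continuous_dual"
    using assms(1) unfolding weak_star_def openin_subtopology by blast
  then obtain U where U: "finite {k. U k \<noteq> UNIV}" "\<And>k. open (U k)"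
    "\<phi> \<in> Pi\<^sub>E UNIV U" "Pi\<^sub>E UNIV U \<subseteq> S"
    using assms(2) by (simp add: openin_product_topology_alt) blast
  define Y where "Y = {k. U k \<noteq> UNIV}"
  have "\<forall>k. \<exists>d>0. ball (\<phi> k) d \<subseteq> U k"
    using U(2,3) by (simp add: PiE_iff open_contains_ball)
  then obtain d where d: "\<And>k. d k > 0" "\<And>k. ball (\<phi> k) (d k) \<subseteq> U k"
    by metis
  \<comment> \<open>The element 1 keeps \<open>Min\<close> meaningful when \<open>Y\<close> is
    empty.\<close>
  define \<delta> where "\<delta> = Min (insert 1 (d ` Y))"
  have fin: "finite (insert 1 (d ` Y))" using U(1) by (simp add: Y_def)
  show thesis
  proof
    show "finite Y" using U(1) by (simp add: Y_def)
    show "\<delta> > 0" unfolding \<delta>_def using fin d by (subst Min_gr_iff) auto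
    fix \<psi> assume \<psi>: "\<psi> \<in> continuous_dual" "\<And>k. k \<in> Y \<Longrightarrow> \<bar>\<psi> k - \<phi> k\<bar> < \<delta>"
    have "\<psi> k \<in> U k" for k
    proof (cases "k \<in> Y")
      case True
      then have "\<delta> \<le> d k" unfolding \<delta>_def using fin by (intro Min_le) auto
      then have "\<psi> k \<in> ball (\<phi> k) (d k)" using \<psi>(2)[OF True] by (simp add: dist_real_def abs_minus_commute)
      then show ?thesis using d by blast
    qed (auto simp: Y_def)
    then show "\<psi> \<in> T" using U(4) S(2) \<psi>(1) by (auto simp: PiE_iff subset_iff)
  qed
qed

text \<open>A weak* neighbourhood of \<open>\<phi>\<close> missing \<open>A\<close> constrains
  finitely many points only. The corresponding set \<open>N\<close> absorbs the space of all
  functions, so it suffices to separate 0 algebraically from \<open>A - \<phi> + N\<close>.\<close>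

lemma weak_star_separation:
  fixes A :: "('a::locally_convex_space \<Rightarrow> real) set"
  assumes A: "convex A" "A \<noteq> {}" "A \<subseteq> continuous_dual"
    and \<phi>: "\<phi> \<in> continuous_dual" "\<phi> \<notin> weak_star closure_of A"
  obtains y \<gamma> where "\<gamma> > 0" "\<And>\<psi>. \<psi> \<in> A \<Longrightarrow> \<psi> y \<le> \<phi> y - \<gamma>"
proof -
  obtain T where T: "openin weak_star T" "\<phi> \<in> T" "T \<inter> A = {}"
    using \<phi> by (auto simp: in_closure_of)
  then obtain Y \<delta> where Y: "finite Y" "\<delta> > 0"
    and nhd: "\<And>\<psi>. \<psi> \<in> continuous_dual \<Longrightarrow> (\<And>k. k \<in> Y \<Longrightarrow> \<bar>\<psi> k - \<phi> k\<bar> < \<delta>) \<Longrightarrow> \<psi> \<in> T"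
    using openin_weak_star_imp_basic by metis
  define N where "N = {\<nu> :: 'a \<Rightarrow> real. \<forall>k\<in>Y. \<bar>\<nu> k\<bar> < \<delta>}"
  define C where "C = {\<psi> - \<phi> + \<nu> | \<psi> \<nu>. \<psi> \<in> A \<and> \<nu> \<in> N}"
  have absorbN: "\<exists>t>0. t *\<^sub>R \<nu> \<in> N" for \<nu>
  proof -
    define M where "M = (\<Sum>k\<in>Y. \<bar>\<nu> k\<bar>) + 1"
    have M: "M > 0" unfolding M_def by (simp add: add_nonneg_pos sum_nonneg)
    have "\<bar>(\<delta> / M) * \<nu> k\<bar> < \<delta>" if "k \<in> Y" for k
    proof -
      have "\<bar>\<nu> k\<bar> < M"
        using member_le_sum[of k Y "\<lambda>k. \<bar>\<nu> k\<bar>"] that Y(1) unfolding M_def by simp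
      then show ?thesis using M Y(2) by (simp add: abs_mult pos_divide_less_eq)
    qed
    then show ?thesis
      using M Y(2) by (intro exI[of _ "\<delta> / M"]) (auto simp: N_def scaleR_fun_def)
  qed
  have "convex N"
  proof (rule convexI)
    fix \<mu> \<nu> and u v :: real
    assume *: "\<mu> \<in> N" "\<nu> \<in> N" "0 \<le> u" "0 \<le> v" "u + v = 1"
    have "\<bar>u * \<mu> k + v * \<nu> k\<bar> < \<delta>" if "k \<in> Y" for k
    proof -
      have "convex (ball (0::real) \<delta>)" by (rule convex_ball)
      then have "u *\<^sub>R \<mu> k + v *\<^sub>R \<nu> k \<in> ball 0 \<delta>"
        using * that by (intro convexD) (auto simp: N_def)
      then show ?thesis by simp
    qed
    then show "u *\<^sub>R \<mu> + v *\<^sub>R \<nu> \<in> N" by (auto simp: N_def scaleR_fun_def)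
  qed
  obtain \<psi>0 where \<psi>0: "\<psi>0 \<in> A" using A(2) by blast
  obtain L where L: "linear L" "\<And>v. v \<in> C \<Longrightarrow> 0 \<le> L v" "L (\<psi>0 - \<phi>) = (1::real)"
  proof (rule convex_absorbing_separation[of C "\<psi>0 - \<phi>"])
    show "convex C"
    proof -
      have "C = (\<Union>x\<in>A. \<Union>y\<in>N. {(- \<phi> + x) + y})" unfolding C_def by force
      also have "\<dots> = (\<Union>x\<in>(+) (- \<phi>) ` A. \<Union>y\<in>N. {x + y})" by auto
      finally show ?thesis
        using convex_sums[OF convex_translation[OF A(1)] \<open>convex N\<close>] by metis
    qed
    show "0 \<notin> C"
    proof
      assume "0 \<in> C"
      then obtain \<psi> \<nu> where *: "\<psi> \<in> A" "\<nu> \<in> N" "0 = \<psi> - \<phi> + \<nu>" unfolding C_def by blast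
      have "\<psi> k - \<phi> k = - \<nu> k" for k using fun_cong[OF *(3), of k] by simp
      then have "\<psi> \<in> T" using * A(3) by (intro nhd) (auto simp: N_def)
      then show False using * T(3) by blast
    qed
    show "\<exists>t>0. \<psi>0 - \<phi> + t *\<^sub>R v \<in> C" for v
      using absorbN[of v] \<psi>0 unfolding C_def by blast
  qed blast
  interpret L: linear L by (rule L(1))
  have lower: "0 \<le> L (\<psi> - \<phi>) + L \<nu>" if "\<psi> \<in> A" "\<nu> \<in> N" for \<psi> \<nu>
    using L(2)[of "\<psi> - \<phi> + \<nu>"] that unfolding C_def L.add[symmetric] by blast
  \<comment> \<open>\<open>L\<close> depends only on the values at the finitely many points of \<open>Y\<close>, so on the dual it is
      evaluation at a vector.\<close>
  have vanish: "L \<nu> = 0" if "\<And>k. k \<in> Y \<Longrightarrow> \<nu> k = 0" for \<nu>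
  proof (rule ccontr)
    assume "L \<nu> \<noteq> 0"
    \<comment> \<open>Every multiple of \<open>\<nu>\<close> lies in \<open>N\<close>; this one has
      \<open>L\<close>-value -2, which the value 1 at \<open>\<psi>0 - \<phi>\<close> cannot
      compensate.\<close>
    have "(- 2 / L \<nu>) *\<^sub>R \<nu> \<in> N" using that Y(2) by (auto simp: N_def scaleR_fun_def)
    from lower[OF \<psi>0 this] show False using L(3) \<open>L \<nu> \<noteq> 0\<close> by (simp add: L.scaleR L.neg)
  qed
  \<comment> \<open>The unit vectors \<open>e k\<close> are not linear, which is why
    \<open>L\<close> has to be defined on all functions. A linear \<open>\<psi>\<close> agrees on
    \<open>Y\<close> with the combination of the \<open>e k\<close> with coefficients
    \<open>\<psi> k\<close>.\<close>
  define e where "e k = (\<lambda>j. if j = k then 1 else 0 :: real)" for k :: 'a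
  define y where "y = (\<Sum>k\<in>Y. L (e k) *\<^sub>R k)"
  have repr: "L \<psi> = \<psi> y" if "linear \<psi>" for \<psi>
  proof -
    interpret \<psi>: linear \<psi> by (rule that)
    have "(\<Sum>k\<in>Y. \<psi> k *\<^sub>R e k) j = \<psi> j" if "j \<in> Y" for j
      using that Y(1) by (simp add: sum_fun_apply scaleR_fun_def e_def if_distrib sum.delta cong: if_cong)
    then have "L (\<psi> - (\<Sum>k\<in>Y. \<psi> k *\<^sub>R e k)) = 0"
      by (intro vanish) simp
    then show ?thesis
      by (simp add: L.diff L.sum L.scaleR y_def \<psi>.sum \<psi>.scaleR mult.commute)
  qed
  \<comment> \<open>Testing \<open>lower\<close> with this element, where \<open>L\<close> equals
    \<open>- t\<close>, improves the weak separation to a gap uniform over \<open>A\<close>.\<close>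
  obtain t where t: "t > 0" "t *\<^sub>R (\<phi> - \<psi>0) \<in> N" using absorbN by blast
  have "L (\<phi> - \<psi>0) = - 1" using L(3) L.neg[of "\<psi>0 - \<phi>"] by simp
  then have gap: "t \<le> L (\<psi> - \<phi>)" if "\<psi> \<in> A" for \<psi>
    using lower[OF that t(2)] by (simp add: L.scaleR)
  show thesis
  proof
    show "t > 0" by fact
    fix \<psi> assume "\<psi> \<in> A"
    then have lin: "linear \<psi>" "linear \<phi>" using A(3) \<phi>(1) by (auto simp: continuous_dual_def)
    then show "\<psi> (- y) \<le> \<phi> (- y) - t"
      using gap[OF \<open>\<psi> \<in> A\<close>] by (simp add: L.diff repr linear_neg)
  qed
qed

section \<open>Approximate subgradients\<close>

lemma tendsto_scaleR_locally_convex: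
  fixes g :: "'b \<Rightarrow> 'a::locally_convex_space"
  assumes "(f \<longlongrightarrow> c) F" "(g \<longlongrightarrow> a) F"
  shows "((\<lambda>x. f x *\<^sub>R g x) \<longlongrightarrow> c *\<^sub>R a) F"
  using filterlim_compose[OF tendsto_scaleR_Pair filterlim_Pair[OF assms]] by simp

lemma continuous_on_scaleR_locally_convex:
  fixes g :: "'b::topological_space \<Rightarrow> 'a::locally_convex_space"
  assumes "continuous_on S f" "continuous_on S g"
  shows "continuous_on S (\<lambda>x. f x *\<^sub>R g x)"
  using assms unfolding continuous_on_def by (auto intro: tendsto_scaleR_locally_convex)

lemma open_absorbing:
  fixes U :: "'a::locally_convex_space set"
  assumes "open U" "0 \<in> U"
  shows "eventually (\<lambda>t. t *\<^sub>R v \<in> U) (at_right 0)"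
proof -
  have "((\<lambda>t. t *\<^sub>R v) \<longlongrightarrow> 0 *\<^sub>R v) (at_right 0)"
    by (intro tendsto_scaleR_locally_convex tendsto_const tendsto_ident_at)
  then show ?thesis using assms by (simp add: topological_tendstoD)
qed

text \<open>The upper bound on \<open>U\<close> is two-sided on the intersection of \<open>U\<close>
  with its reflection, and shrinking this set by the factor \<open>k\<close> makes the oscillation
  of \<open>\<zeta>\<close> small.\<close>

lemma linear_bounded_on_nhd_in_continuous_dual:
  fixes \<zeta> :: "'a::locally_convex_space \<Rightarrow> real"
  assumes "linear \<zeta>" "open U" "0 \<in> U" and bound: "\<And>u. u \<in> U \<Longrightarrow> \<zeta> u \<le> B"
  shows "\<zeta> \<in> continuous_dual"
proof -
  interpret linear \<zeta> by fact
  have B: "0 \<le> B" using bound[OF assms(3)] zero by simp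
  have "(\<zeta> \<longlongrightarrow> \<zeta> x) (at x)" for x
  proof (rule tendstoI)
    fix e :: real assume "e > 0"
    define k where "k = (B + 1) / e"
    have k: "k > 0" using B \<open>e > 0\<close> by (simp add: k_def)
    define V where "V = (\<lambda>v. k *\<^sub>R (v - x)) -` U \<inter> (\<lambda>v. (- k) *\<^sub>R (v - x)) -` U"
    have "open V"
      unfolding V_def using \<open>open U\<close>
      by (intro open_Int open_vimage continuous_on_scaleR_locally_convex continuous_intros)
    moreover have "x \<in> V" using assms(3) by (simp add: V_def)
    moreover have "dist (\<zeta> v) (\<zeta> x) < e" if "v \<in> V" for v
    proof -
      have "k * (\<zeta> v - \<zeta> x) \<le> B" "- k * (\<zeta> v - \<zeta> x) \<le> B"
        using that bound[of "k *\<^sub>R (v - x)"] bound[of "(- k) *\<^sub>R (v - x)"]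
        by (auto simp: V_def scaleR diff neg)
      then have "k * \<bar>\<zeta> v - \<zeta> x\<bar> \<le> B" by (simp add: abs_if algebra_simps)
      also have "B < k * e" using \<open>e > 0\<close> by (simp add: k_def)
      finally show ?thesis using k by (simp add: dist_real_def)
    qed
    ultimately show "eventually (\<lambda>v. dist (\<zeta> v) (\<zeta> x) < e) (at x)"
      unfolding eventually_at_topological by blast
  qed
  then show ?thesis
    using assms(1) by (simp add: continuous_dual_def continuous_on_def)
qed

section \<open>Lower semicontinuous hulls\<close>

lemma open_superlevel:
  fixes h :: "'a::topological_space \<Rightarrow> ereal"
  assumes "lower_semicontinuous_map euclidean h"
  shows "open {v. c < h v}"
proof -
  have "closed {v. h v \<le> c}"
    using assms by (simp add: lower_semicontinuous_map_def)
  moreover have "{v. c < h v} = - {v. h v \<le> c}" by auto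
  ultimately show ?thesis by (simp add: open_Compl)
qed

lemma lsc_hull_le: "lsc_hull f x \<le> f x"
  unfolding lsc_hull_def by (rule SUP_least) (simp add: le_fun_def)

lemma lsc_hull_greatest:
  assumes "lower_semicontinuous_map euclidean g" "g \<le> f"
  shows "g x \<le> lsc_hull f x"
  unfolding lsc_hull_def using assms by (intro SUP_upper) simp

lemma lower_semicontinuous_lsc_hull: "lower_semicontinuous_map euclidean (lsc_hull f)"
proof -
  have "{x. lsc_hull f x \<le> c}
      = (\<Inter>g\<in>{g. lower_semicontinuous_map euclidean g \<and> g \<le> f}. {x. g x \<le> c})" for c
    by (auto simp: lsc_hull_def SUP_le_iff)
  moreover have "closed (\<Inter>g\<in>{g. lower_semicontinuous_map euclidean g \<and> g \<le> f}. {x. g x \<le> c})" for c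
    by (intro closed_INT) (auto simp: lower_semicontinuous_map_def)
  ultimately show ?thesis by (simp add: lower_semicontinuous_map_def)
qed

text \<open>Solving the convexity inequality for the value at the moving endpoint gives a lower
  semicontinuous minorant \<open>g\<close> of \<open>f\<close>, which therefore lies below the hull.
  The real value of \<open>f\<close> at the fixed endpoint makes the subtraction legitimate.\<close>

lemma lsc_hull_segment:
  fixes f :: "'a::locally_convex_space \<Rightarrow> ereal"
  assumes "convex_fun f" and a: "f x = ereal a" and \<theta>: "0 < \<theta>" "\<theta> < 1"
    and v: "lsc_hull f v \<le> ereal b"
  shows "lsc_hull f ((1 - \<theta>) *\<^sub>R x + \<theta> *\<^sub>R v) \<le> ereal ((1 - \<theta>) * a + \<theta> * b)"
proof -
  define g where "g w = (lsc_hull f ((1 - \<theta>) *\<^sub>R x + \<theta> *\<^sub>R w) - ereal ((1 - \<theta>) * a)) / ereal \<theta>" for w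
  have g_le: "g w \<le> c \<longleftrightarrow> lsc_hull f ((1 - \<theta>) *\<^sub>R x + \<theta> *\<^sub>R w) \<le> ereal ((1 - \<theta>) * a) + ereal \<theta> * c" for w c
    using \<theta> by (cases "lsc_hull f ((1 - \<theta>) *\<^sub>R x + \<theta> *\<^sub>R w)"; cases c)
      (auto simp: g_def field_simps)
  have "continuous_on UNIV (\<lambda>w. (1 - \<theta>) *\<^sub>R x + \<theta> *\<^sub>R w)"
    by (intro continuous_on_scaleR_locally_convex continuous_intros)
  then have "closed ((\<lambda>w. (1 - \<theta>) *\<^sub>R x + \<theta> *\<^sub>R w) -` {u. lsc_hull f u \<le> c})" for c
    using lower_semicontinuous_lsc_hull[of f]
    by (intro closed_vimage) (simp_all add: lower_semicontinuous_map_def)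
  then have "lower_semicontinuous_map euclidean g"
    unfolding lower_semicontinuous_map_def g_le by (simp add: vimage_def)
  moreover have "g w \<le> f w" for w
  proof -
    have "lsc_hull f ((1 - \<theta>) *\<^sub>R x + \<theta> *\<^sub>R w) \<le> f ((1 - \<theta>) *\<^sub>R x + \<theta> *\<^sub>R w)"
      by (rule lsc_hull_le)
    also have "\<dots> \<le> ereal (1 - \<theta>) * f x + ereal \<theta> * f w"
      using assms(1) \<theta> by (simp add: convex_fun_def)
    finally show ?thesis using a by (simp add: g_le)
  qed
  ultimately have "g v \<le> lsc_hull f v"
    by (intro lsc_hull_greatest) (simp_all add: le_fun_def)
  then have "g v \<le> ereal b" using v by (rule order_trans)
  then show ?thesis by (simp add: g_le)
qed

text \<open>Adds the endpoint weights that \<open>convex_fun\<close> leaves out; real upper bounds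
  keep +infinity out of the arithmetic.\<close>

lemma convex_fun_epigraph:
  assumes "convex_fun f" "f w \<le> ereal s" "f w' \<le> ereal s'" "0 \<le> p" "0 \<le> q" "p + q = 1"
  shows "f (p *\<^sub>R w + q *\<^sub>R w') \<le> ereal (p * s + q * s')"
proof -
  have p: "p = 1 - q" using assms by simp
  consider "q = 0" | "q = 1" | "0 < q" "q < 1" using assms by linarith
  then show ?thesis
  proof cases
    case 3
    then have "f (p *\<^sub>R w + q *\<^sub>R w') \<le> ereal (1 - q) * f w + ereal q * f w'"
      using assms(1) by (simp add: convex_fun_def p)
    also have "\<dots> \<le> ereal (1 - q) * ereal s + ereal q * ereal s'"
      using assms 3 by (intro add_mono ereal_mult_left_mono) auto
    finally show ?thesis by (simp add: p)
  qed (use assms in auto)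
qed

text \<open>The segment below the epigraph of \<open>lsc_hull f\<close> is compact, so a neighbourhood \<open>U\<close> can be
  inserted between the two before separating.\<close>

lemma eps_subgradient_exists:
  fixes f :: "'a::locally_convex_space \<Rightarrow> ereal"
  assumes cf: "convex_fun f" and a: "f x = ereal a" and "\<epsilon> > 0" "T > 0"
    and segment: "\<And>t. 0 \<le> t \<Longrightarrow> t \<le> T \<Longrightarrow> ereal (a - \<epsilon> + r * t) < lsc_hull f (x + t *\<^sub>R y)"
  shows "\<exists>\<zeta>\<in>eps_subdifferential \<epsilon> f x. r - \<epsilon> / T \<le> \<zeta> y"
proof -
  \<comment> \<open>The first component of \<open>p\<close> is a perturbation, the second a
    parameter on the segment. Membership means that the shifted segment point is still strictly
    below the hull. Inserting a real \<open>c\<close> splits this into two open conditions.\<close>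
  define W where "W = {p. ereal (a - \<epsilon> + r * snd p) < lsc_hull f (x + snd p *\<^sub>R y - fst p)}"
  have "open W"
  proof (subst open_subopen, intro ballI)
    fix p assume "p \<in> W"
    then obtain c where c: "ereal (a - \<epsilon> + r * snd p) < ereal c" "ereal c < lsc_hull f (x + snd p *\<^sub>R y - fst p)"
      unfolding W_def using ereal_dense2 by blast
    define S where "S = (\<lambda>p. x + snd p *\<^sub>R y - fst p) -` {v. ereal c < lsc_hull f v}
      \<inter> {p. a - \<epsilon> + r * snd p < c}"
    have "open S" unfolding S_def
      by (intro open_Int open_vimage open_superlevel lower_semicontinuous_lsc_hull open_Collect_less
          continuous_on_scaleR_locally_convex continuous_intros)
    moreover have "p \<in> S" using c by (simp add: S_def)
    moreover have "S \<subseteq> W"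
      unfolding S_def W_def by (auto intro: less_trans[of "ereal _" "ereal c"])
    ultimately show "\<exists>S. open S \<and> p \<in> S \<and> S \<subseteq> W" by blast
  qed
  moreover have "{0} \<times> {0..T} \<subseteq> W" using segment by (auto simp: W_def)
  ultimately obtain U0 where "0 \<in> U0" "open U0" and U0: "U0 \<times> {0..T} \<subseteq> W"
    using Elementary_Topology.tube_lemma[of "{0..T}" W "0 :: 'a"] by auto
  then obtain U where U: "open U" "convex U" "0 \<in> U" "U \<subseteq> U0"
    using ex_convex_nhd by blast
  \<comment> \<open>Differences of epigraph points and segment points, thickened by
    \<open>U\<close>. If 0 were among them, an epigraph point would lie strictly below the
    hull.\<close>
  define C where "C = {(w - x - t *\<^sub>R y + u, s - (a - \<epsilon> + r * t)) | w s t u.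
    f w \<le> ereal s \<and> 0 \<le> t \<and> t \<le> T \<and> u \<in> U}"
  have CI: "(w - x - t *\<^sub>R y + u, s - (a - \<epsilon> + r * t)) \<in> C"
    if "f w \<le> ereal s" "0 \<le> t" "t \<le> T" "u \<in> U" for w s t u
    using that unfolding C_def by blast
  \<comment> \<open>The order unit comes from the epigraph point \<open>(x, a + 1)\<close> and
    \<open>t = 0\<close>. The spare 1 leaves room in the real component, and \<open>U\<close> in the
    vector component.\<close>
  obtain L where L: "linear L" "\<And>v. v \<in> C \<Longrightarrow> 0 \<le> L v" "L (0, 1 + \<epsilon>) = (1::real)"
  proof (rule convex_absorbing_separation[of C "(0, 1 + \<epsilon>)"])
    show "convex C"
    proof (rule convexI)
      fix v v' and p q :: real
      assume v: "v \<in> C" "v' \<in> C" and pq: "0 \<le> p" "0 \<le> q" "p + q = 1"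
      obtain w s t u where 1: "v = (w - x - t *\<^sub>R y + u, s - (a - \<epsilon> + r * t))"
        "f w \<le> ereal s" "0 \<le> t" "t \<le> T" "u \<in> U"
        using v(1) unfolding C_def by blast
      obtain w' s' t' u' where 2: "v' = (w' - x - t' *\<^sub>R y + u', s' - (a - \<epsilon> + r * t'))"
        "f w' \<le> ereal s'" "0 \<le> t'" "t' \<le> T" "u' \<in> U"
        using v(2) unfolding C_def by blast
      have t: "0 \<le> p * t + q * t'" "p * t + q * t' \<le> T"
        using 1 2 pq convex_bound_le[of t T t' p q] by auto
      have q: "q = 1 - p" using pq by simp
      have "p *\<^sub>R v + q *\<^sub>R v' = ((p *\<^sub>R w + q *\<^sub>R w') - x - (p * t + q * t') *\<^sub>R y + (p *\<^sub>R u + q *\<^sub>R u'),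
          (p * s + q * s') - (a - \<epsilon> + r * (p * t + q * t')))"
        unfolding 1 2 q by (simp add: algebra_simps)
      also have "\<dots> \<in> C"
        using 1 2 pq t U(2) by (intro CI convex_fun_epigraph[OF cf] convexD) auto
      finally show "p *\<^sub>R v + q *\<^sub>R v' \<in> C" .
    qed
    show "0 \<notin> C"
    proof
      assume "0 \<in> C"
      then obtain w s t u where *: "0 = w - x - t *\<^sub>R y + u" "0 = s - (a - \<epsilon> + r * t)"
        "f w \<le> ereal s" "0 \<le> t" "t \<le> T" "u \<in> U"
        unfolding C_def zero_prod_def by blast
      then have "(u, t) \<in> W" using U(4) U0 by auto
      moreover have "w = x + t *\<^sub>R y - u" using *(1) by (simp add: algebra_simps)
      moreover have "s = a - \<epsilon> + r * t" using *(2) by simp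
      ultimately have "ereal s < lsc_hull f w" by (simp add: W_def)
      then show False using *(3) lsc_hull_le[of f w] by simp
    qed
    fix v :: "'a \<times> real"
    have "eventually (\<lambda>\<tau>. \<tau> *\<^sub>R fst v \<in> U) (at_right 0)" using U by (intro open_absorbing)
    moreover have "eventually (\<lambda>\<tau>. \<tau> *\<^sub>R snd v \<in> ball 0 1) (at_right 0)" by (intro open_absorbing) auto
    moreover have "eventually (\<lambda>\<tau>. \<tau> > (0::real)) (at_right 0)" by (rule eventually_at_right_less)
    ultimately have "eventually (\<lambda>\<tau>. \<tau> *\<^sub>R fst v \<in> U \<and> \<tau> *\<^sub>R snd v \<in> ball 0 1 \<and> \<tau> > 0) (at_right 0)"
      by (intro eventually_conj)
    then obtain \<tau> where \<tau>: "\<tau> *\<^sub>R fst v \<in> U" "\<bar>\<tau> * snd v\<bar> < 1" "\<tau> > 0"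
      using eventually_happens'[OF trivial_limit_at_right_real] by fastforce
    have "(x - x - 0 *\<^sub>R y + \<tau> *\<^sub>R fst v, (a + 1 + \<tau> * snd v) - (a - \<epsilon> + r * 0)) \<in> C"
      using \<tau> a \<open>T > 0\<close> by (intro CI) auto
    also have "(x - x - 0 *\<^sub>R y + \<tau> *\<^sub>R fst v, (a + 1 + \<tau> * snd v) - (a - \<epsilon> + r * 0)) = (0, 1 + \<epsilon>) + \<tau> *\<^sub>R v"
      by (simp add: prod_eq_iff)
    finally show "\<exists>\<tau>>0. (0, 1 + \<epsilon>) + \<tau> *\<^sub>R v \<in> C" using \<tau>(3) by blast
  qed blast
  interpret L: linear L by (rule L(1))
  define \<beta> where "\<beta> = L (0, 1)"
  have L_eq: "L (v, s) = L (v, 0) + s * \<beta>" for v s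
    using L.add[of "(v, 0)" "(0, s)"] L.scaleR[of s "(0, 1)"] by (simp add: \<beta>_def)
  \<comment> \<open>The normalisation of \<open>L\<close> reads
    \<open>(1 + \<epsilon>) * \<beta> = 1\<close>, so the separating hyperplane is not
    vertical.\<close>
  have \<beta>: "\<beta> > 0" using L(3) L_eq[of 0 "1 + \<epsilon>"] L.zero \<open>\<epsilon> > 0\<close>
    by (metis add_pos_pos linorder_not_less mult_nonneg_nonpos zero_less_one zero_prod_def add_0 less_le_not_le)
  define \<zeta> where "\<zeta> v = - L (v, 0) / \<beta>" for v
  have lin: "linear \<zeta>"
  proof (rule linearI)
    show "\<zeta> (v + w) = \<zeta> v + \<zeta> w" for v w
      using L.add[of "(v, 0)" "(w, 0)"] by (simp add: \<zeta>_def add_divide_distrib diff_divide_distrib)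
    show "\<zeta> (k *\<^sub>R v) = k *\<^sub>R \<zeta> v" for k v
      using L.scaleR[of k "(v, 0)"] by (simp add: \<zeta>_def)
  qed
  \<comment> \<open>Three cases matter: \<open>t = 0, u = 0\<close> gives the subgradient
    inequality; \<open>w = x, t = 0\<close> bounds \<open>\<zeta>\<close> by
    \<open>\<epsilon>\<close> on \<open>U\<close>, hence continuity;
    \<open>w = x, t = T, u = 0\<close> gives the slope along \<open>y\<close>.\<close>
  have main: "\<zeta> (w - x - t *\<^sub>R y + u) \<le> s - (a - \<epsilon> + r * t)"
    if "f w \<le> ereal s" "0 \<le> t" "t \<le> T" "u \<in> U" for w s t u
    using L(2)[OF CI[OF that]] \<beta> unfolding L_eq[of _ "s - _"] \<zeta>_def by (simp add: field_simps)
  have upper: "\<zeta> (w - x) \<le> s - a + \<epsilon>" if "f w \<le> ereal s" for w s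
    using main[OF that, of 0 0] U(3) \<open>T > 0\<close> by simp
  have dual: "\<zeta> \<in> continuous_dual"
    using main[of x a 0] a \<open>T > 0\<close> by (intro linear_bounded_on_nhd_in_continuous_dual[OF lin U(1,3), of \<epsilon>]) auto
  have "ereal (\<zeta> (w - x)) + f x \<le> f w + ereal \<epsilon>" for w
  proof -
    have "ereal (\<zeta> (w - x) + a - \<epsilon>) \<le> f w"
      by (rule ereal_le_real) (use upper in fastforce)
    then show ?thesis by (cases "f w") (auto simp: a)
  qed
  then have "\<zeta> \<in> eps_subdifferential \<epsilon> f x"
    using dual by (simp add: eps_subdifferential_def a)
  moreover have "- (T * \<zeta> y) \<le> \<epsilon> - r * T"
  proof -
    have "\<zeta> (- (T *\<^sub>R y)) \<le> \<epsilon> - r * T" using main[of x a T 0] U(3) a \<open>T > 0\<close> by simp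
    then show ?thesis using lin by (simp add: linear_neg linear_scale)
  qed
  then have "r - \<epsilon> / T \<le> \<zeta> y" using \<open>T > 0\<close> by (simp add: field_simps)
  ultimately show ?thesis by blast
qed

section \<open>Subdifferentials of sums\<close>

lemma continuous_dual_add:
  "\<phi> \<in> continuous_dual \<Longrightarrow> \<psi> \<in> continuous_dual \<Longrightarrow> \<phi> + \<psi> \<in> continuous_dual"
  by (auto simp: continuous_dual_def plus_fun_def linear_iff algebra_simps intro!: continuous_intros)

lemma continuous_dual_scaleR:
  "\<phi> \<in> continuous_dual \<Longrightarrow> c *\<^sub>R \<phi> \<in> continuous_dual"
  by (auto simp: continuous_dual_def scaleR_fun_def linear_iff algebra_simps intro!: continuous_intros)

lemma continuous_dual_sum:
  assumes "\<And>i. i \<in> I \<Longrightarrow> z i \<in> continuous_dual"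
  shows "(\<Sum>i\<in>I. z i) \<in> continuous_dual"
proof -
  have "linear (\<lambda>x. \<Sum>i\<in>I. z i x)" "continuous_on UNIV (\<lambda>x. \<Sum>i\<in>I. z i x)"
    using assms by (auto simp: continuous_dual_def intro!: linear_compose_sum continuous_on_sum)
  moreover have "(\<Sum>i\<in>I. z i) = (\<lambda>x. \<Sum>i\<in>I. z i x)" by (simp add: fun_eq_iff sum_fun_apply)
  ultimately show ?thesis by (simp add: continuous_dual_def)
qed

lemma continuous_dual_diff_arg: "\<phi> \<in> continuous_dual \<Longrightarrow> \<phi> (u - v) = \<phi> u - \<phi> v"
  by (simp add: continuous_dual_def linear_diff)

text \<open>The subgradient inequality, rearranged and maximised over the test point, says that the
  Fenchel-Young gap at \<open>x\<close> is at most \<open>\<epsilon>\<close>.\<close>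

lemma eps_subdifferential_iff_conjugate:
  assumes "f x = ereal a"
  shows "\<zeta> \<in> eps_subdifferential \<epsilon> f x \<longleftrightarrow>
    \<zeta> \<in> continuous_dual \<and> fenchel_conjugate f \<zeta> \<le> ereal (\<zeta> x - a + \<epsilon>)"
proof -
  have "ereal (\<zeta> (v - x)) + ereal a \<le> f v + ereal \<epsilon> \<longleftrightarrow> ereal (\<zeta> v) - f v \<le> ereal (\<zeta> x - a + \<epsilon>)"
    if "\<zeta> \<in> continuous_dual" for v
    using continuous_dual_diff_arg[OF that, of v x] by (cases "f v") auto
  then show ?thesis
    by (auto simp: eps_subdifferential_def fenchel_conjugate_def SUP_le_iff assms)
qed

lemma eps_subdifferential_subset_dual: "eps_subdifferential \<epsilon> f x \<subseteq> continuous_dual"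
  by (simp add: eps_subdifferential_def)

lemma eps_subdifferential_mono:
  assumes "\<epsilon> \<le> \<epsilon>'"
  shows "eps_subdifferential \<epsilon> f x \<subseteq> eps_subdifferential \<epsilon>' f x"
proof -
  have "f y + ereal \<epsilon> \<le> f y + ereal \<epsilon>'" for y
    using assms by (intro add_left_mono) simp
  then show ?thesis unfolding eps_subdifferential_def by (auto intro: order_trans)
qed

lemma convex_eps_subdifferential: "convex (eps_subdifferential \<epsilon> f x)"
proof (cases "\<bar>f x\<bar> = \<infinity>")
  case False
  then obtain a where a: "f x = ereal a" by auto
  show ?thesis
  proof (rule convexI)
    fix \<zeta> \<xi> and u v :: real
    assume *: "\<zeta> \<in> eps_subdifferential \<epsilon> f x" "\<xi> \<in> eps_subdifferential \<epsilon> f x" and uv: "0 \<le> u" "0 \<le> v" "u + v = 1"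
    have "ereal ((u *\<^sub>R \<zeta> + v *\<^sub>R \<xi>) (y - x)) + f x \<le> f y + ereal \<epsilon>" for y
    proof -
      have le: "ereal (\<zeta> (y - x)) + f x \<le> f y + ereal \<epsilon>" "ereal (\<xi> (y - x)) + f x \<le> f y + ereal \<epsilon>"
        using * a by (auto simp: eps_subdifferential_def)
      show ?thesis
      proof (cases "f y")
        case (real b)
        then have "u * \<zeta> (y - x) + v * \<xi> (y - x) \<le> b + \<epsilon> - a"
          using le uv a by (intro convex_bound_le) auto
        then show ?thesis by (simp add: a real scaleR_fun_def)
      next
        case MInf
        then show ?thesis using le(1) by (simp add: a)
      qed (auto simp: a)
    qed
    then show "u *\<^sub>R \<zeta> + v *\<^sub>R \<xi> \<in> eps_subdifferential \<epsilon> f x"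
      using * a by (auto simp: eps_subdifferential_def continuous_dual_add continuous_dual_scaleR)
  qed
qed (simp add: eps_subdifferential_def)

section \<open>Finite Minkowski sums\<close>

lemma mem_sum_sets_iff:
  "finite I \<Longrightarrow> \<phi> \<in> (\<Sum>i\<in>I. A i) \<longleftrightarrow> (\<exists>z. (\<forall>i\<in>I. z i \<in> A i) \<and> \<phi> = (\<Sum>i\<in>I. z i))"
  for A :: "'i \<Rightarrow> 'a::comm_monoid_add set"
  using set_sum_alt[of I A] by auto

lemma sum_sets_memI:
  "finite I \<Longrightarrow> (\<And>i. i \<in> I \<Longrightarrow> z i \<in> A i) \<Longrightarrow> (\<Sum>i\<in>I. z i) \<in> (\<Sum>i\<in>I. A i)"
  for A :: "'i \<Rightarrow> 'a::comm_monoid_add set"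
  unfolding mem_sum_sets_iff by (intro exI[of _ z]) simp

lemma sum_eps_subdifferential_subset_dual:
  assumes "finite I"
  shows "(\<Sum>i\<in>I. eps_subdifferential \<epsilon> (f i) x) \<subseteq> continuous_dual"
proof
  fix \<phi> assume "\<phi> \<in> (\<Sum>i\<in>I. eps_subdifferential \<epsilon> (f i) x)"
  then obtain z where "\<forall>i\<in>I. z i \<in> eps_subdifferential \<epsilon> (f i) x" and \<phi>: "\<phi> = (\<Sum>i\<in>I. z i)"
    unfolding mem_sum_sets_iff[OF assms] by blast
  then have "z i \<in> continuous_dual" if "i \<in> I" for i
    using that eps_subdifferential_subset_dual by blast
  then show "\<phi> \<in> continuous_dual" unfolding \<phi> by (rule continuous_dual_sum)
qed

lemma sum_sets_mono:
  fixes A :: "'i \<Rightarrow> 'a::comm_monoid_add set"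
  assumes "finite I" and sub: "\<And>i. i \<in> I \<Longrightarrow> A i \<subseteq> B i"
  shows "(\<Sum>i\<in>I. A i) \<subseteq> (\<Sum>i\<in>I. B i)"
proof
  fix \<phi> assume "\<phi> \<in> (\<Sum>i\<in>I. A i)"
  then obtain z where z: "\<forall>i\<in>I. z i \<in> A i" and \<phi>: "\<phi> = (\<Sum>i\<in>I. z i)"
    unfolding mem_sum_sets_iff[OF assms(1)] by blast
  show "\<phi> \<in> (\<Sum>i\<in>I. B i)"
    unfolding \<phi> using z sub by (intro sum_sets_memI assms(1)) blast
qed

lemma convex_sum_sets:
  fixes A :: "'i \<Rightarrow> 'a::real_vector set"
  assumes "finite I" "\<And>i. i \<in> I \<Longrightarrow> convex (A i)"
  shows "convex (\<Sum>i\<in>I. A i)"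
proof (rule convexI)
  fix \<phi> \<psi> and u v :: real
  assume *: "\<phi> \<in> (\<Sum>i\<in>I. A i)" "\<psi> \<in> (\<Sum>i\<in>I. A i)" and uv: "0 \<le> u" "0 \<le> v" "u + v = 1"
  obtain z w where z: "\<forall>i\<in>I. z i \<in> A i" "\<phi> = (\<Sum>i\<in>I. z i)"
    and w: "\<forall>i\<in>I. w i \<in> A i" "\<psi> = (\<Sum>i\<in>I. w i)"
    using * unfolding mem_sum_sets_iff[OF assms(1)] by blast
  have eq: "u *\<^sub>R \<phi> + v *\<^sub>R \<psi> = (\<Sum>i\<in>I. u *\<^sub>R z i + v *\<^sub>R w i)"
    by (simp add: z w scaleR_sum_right sum.distrib)
  have "u *\<^sub>R z i + v *\<^sub>R w i \<in> A i" if "i \<in> I" for i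
    using z(1) w(1) that by (intro convexD[OF assms(2)] uv) auto
  then show "u *\<^sub>R \<phi> + v *\<^sub>R \<psi> \<in> (\<Sum>i\<in>I. A i)"
    unfolding eq by (rule sum_sets_memI[OF assms(1)])
qed

text \<open>A single summand +infinity makes an \<open>ereal\<close> sum +infinity, and -infinity is
  excluded by assumption.\<close>

lemma finite_sum_ereal_imp_finite:
  fixes f :: "'i \<Rightarrow> ereal"
  assumes "finite I" "\<And>i. i \<in> I \<Longrightarrow> f i \<noteq> - \<infinity>" "\<bar>\<Sum>i\<in>I. f i\<bar> \<noteq> \<infinity>"
  obtains a where "\<And>i. i \<in> I \<Longrightarrow> f i = ereal (a i)"
proof -
  have fin: "f i \<noteq> \<infinity>" if "i \<in> I" for i
  proof
    assume "f i = \<infinity>"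
    then have "(\<Sum>i\<in>I. f i) = \<infinity>" using assms(1) that by (simp only: sum_Pinfty) blast
    then show False using assms(3) by simp
  qed
  show thesis
  proof (rule that)
    show "f i = ereal (real_of_ereal (f i))" if "i \<in> I" for i
      using fin[OF that] assms(2)[OF that] by (cases "f i") simp_all
  qed
qed

text \<open>Serves to replace a support function, up to \<open>\<delta>\<close>, by the value of one
  chosen functional.\<close>

lemma exists_almost_maximizer:
  fixes g :: "'b \<Rightarrow> real"
  assumes "D \<noteq> {}" "\<And>z. z \<in> D \<Longrightarrow> g z \<le> B" "\<delta> > 0"
  shows "\<exists>z\<in>D. \<forall>w\<in>D. g w \<le> g z + \<delta>"
proof -
  have ne: "g ` D \<noteq> {}" using assms(1) by simp
  have bdd: "bdd_above (g ` D)" using assms(2) by (rule bdd_aboveI2)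
  have "\<exists>u\<in>g ` D. Sup (g ` D) - \<delta> < u"
    using less_cSup_iff[OF ne bdd, of "Sup (g ` D) - \<delta>"] \<open>\<delta> > 0\<close> by simp
  then obtain z where z: "z \<in> D" "Sup (g ` D) - \<delta> < g z" by blast
  have "g w \<le> g z + \<delta>" if "w \<in> D" for w
    using cSup_upper[OF imageI[OF that, of g] bdd] z(2) by simp
  then show ?thesis using z(1) by blast
qed

text \<open>If \<open>\<phi>\<close> were separated from the sum by \<open>y\<close>, then at some \<open>t > 0\<close> common to all \<open>i\<close> the hulls
  would satisfy \<open>h\<^sub>i (x + t y) \<le> f\<^sub>i x + r\<^sub>i t\<close> with \<open>\<Sum> r\<^sub>i < \<phi> y\<close>. That point lies in the domain of
  all hulls, so there the hulls may be replaced by the \<open>f\<^sub>i\<close>, contradicting \<open>\<phi> \<in> \<partial>(\<Sum> f\<^sub>i)(x)\<close>.\<close>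

lemma subdifferential_sum_subset_closure:
  fixes f :: "'i \<Rightarrow> 'a::locally_convex_space \<Rightarrow> ereal"
  assumes I: "finite I" and nm: "\<And>i v. i \<in> I \<Longrightarrow> f i v \<noteq> - \<infinity>"
    and cf: "\<And>i. i \<in> I \<Longrightarrow> convex_fun (f i)"
    and hull: "\<And>i v. i \<in> I \<Longrightarrow> v \<in> (\<Inter>j\<in>I. effective_domain (lsc_hull (f j))) \<Longrightarrow> lsc_hull (f i) v = f i v"
    and \<phi>: "\<phi> \<in> subdifferential (\<lambda>v. \<Sum>i\<in>I. f i v) x" and "\<epsilon> > 0"
  shows "\<phi> \<in> weak_star closure_of (\<Sum>i\<in>I. eps_subdifferential \<epsilon> (f i) x)"
proof (rule ccontr)
  let ?D = "\<lambda>i. eps_subdifferential \<epsilon> (f i) x"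
  assume contr: "\<phi> \<notin> weak_star closure_of (\<Sum>i\<in>I. ?D i)"
  have \<phi>d: "\<phi> \<in> continuous_dual"
    and \<phi>sub: "\<And>v. ereal (\<phi> (v - x)) + (\<Sum>i\<in>I. f i x) \<le> (\<Sum>i\<in>I. f i v)"
    and fin: "\<bar>\<Sum>i\<in>I. f i x\<bar> \<noteq> \<infinity>"
    using \<phi> by (auto simp: eps_subdifferential_def split: if_splits)
  obtain a where a: "\<And>i. i \<in> I \<Longrightarrow> f i x = ereal (a i)"
    using finite_sum_ereal_imp_finite[OF I nm fin] by blast
  have "lsc_hull (f j) x < \<infinity>" if "j \<in> I" for j
    using lsc_hull_le[of "f j" x] a[OF that] by auto
  then have "x \<in> (\<Inter>j\<in>I. effective_domain (lsc_hull (f j)))" by (simp add: effective_domain_def)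
  then have hx: "lsc_hull (f i) x = ereal (a i)" if "i \<in> I" for i
    using hull a that by simp
  \<comment> \<open>The degenerate segment with slope 0 and direction 0 only asks that the hull at
    \<open>x\<close> exceed \<open>a i - \<epsilon>\<close>, which holds since it equals
    \<open>a i\<close> there.\<close>
  have ne: "?D i \<noteq> {}" if "i \<in> I" for i
    using eps_subgradient_exists[OF cf[OF that] a[OF that] \<open>\<epsilon> > 0\<close>, of 1 0 0] hx[OF that] \<open>\<epsilon> > 0\<close> by auto
  define z0 where "z0 i = (SOME z. z \<in> ?D i)" for i
  have z0: "z0 i \<in> ?D i" if "i \<in> I" for i
    using ne[OF that] unfolding z0_def by (simp add: some_in_eq)
  have "(\<Sum>i\<in>I. z0 i) \<in> (\<Sum>i\<in>I. ?D i)" using I z0 by (rule sum_sets_memI)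
  then have neD: "(\<Sum>i\<in>I. ?D i) \<noteq> {}" by (metis empty_iff)
  obtain y \<gamma> where \<gamma>: "\<gamma> > 0"
    and sep: "\<And>\<psi>. \<psi> \<in> (\<Sum>i\<in>I. ?D i) \<Longrightarrow> \<psi> y \<le> \<phi> y - \<gamma>"
    by (rule weak_star_separation[OF convex_sum_sets[OF I convex_eps_subdifferential] neD
        sum_eps_subdifferential_subset_dual[OF I] \<phi>d contr]) blast
  have sep': "(\<Sum>i\<in>I. z i y) \<le> \<phi> y - \<gamma>" if "\<And>i. i \<in> I \<Longrightarrow> z i \<in> ?D i" for z
    using sep[OF sum_sets_memI[OF I, of z ?D]] that by (simp add: sum_fun_apply)
  \<comment> \<open>Each index will spend \<open>2 * \<delta>\<close>. The added 1 keeps the total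
    strictly below \<open>\<gamma>\<close> and the denominator positive for empty
    \<open>I\<close>.\<close>
  define \<delta> where "\<delta> = \<gamma> / (2 * card I + 1)"
  have \<delta>: "\<delta> > 0" using \<gamma> by (simp add: \<delta>_def)
  have "\<exists>z\<in>?D i. \<forall>w\<in>?D i. w y \<le> z y + \<delta>" if "i \<in> I" for i
  proof (rule exists_almost_maximizer[OF ne[OF that] _ \<delta>])
    fix w assume "w \<in> ?D i"
    \<comment> \<open>Holding the other components at \<open>z0\<close> turns the bound on the whole
      sum into a bound on one summand.\<close>
    then have "(\<Sum>j\<in>I. (z0(i := w)) j y) \<le> \<phi> y - \<gamma>" using z0 by (intro sep') auto
    also have "(\<Sum>j\<in>I. (z0(i := w)) j y) = w y + (\<Sum>j\<in>I - {i}. z0 j y)"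
      using that I by (simp add: sum.remove[of I i])
    finally show "w y \<le> \<phi> y - \<gamma> - (\<Sum>j\<in>I - {i}. z0 j y)" by simp
  qed
  then obtain z where z: "\<And>i. i \<in> I \<Longrightarrow> z i \<in> ?D i"
    and zmax: "\<And>i w. i \<in> I \<Longrightarrow> w \<in> ?D i \<Longrightarrow> w y \<le> z i y + \<delta>"
    by metis
  define r where "r i = z i y + 2 * \<delta>" for i
  have r: "(\<Sum>i\<in>I. r i) < \<phi> y"
  proof -
    have "(\<Sum>i\<in>I. r i) \<le> \<phi> y - \<gamma> + 2 * card I * \<delta>"
      using sep'[OF z] by (simp add: r_def sum.distrib)
    also have "2 * card I * \<delta> < \<gamma>" using \<gamma> by (simp add: \<delta>_def field_simps)
    finally show ?thesis by simp
  qed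
  have "\<exists>t>0. lsc_hull (f i) (x + t *\<^sub>R y) \<le> ereal (a i - \<epsilon> + r i * t)" if i: "i \<in> I" for i
  proof (rule ccontr)
    assume no: "\<not> ?thesis"
    \<comment> \<open>On failure the hull stays above a line of slope \<open>r i\<close> along the
      whole ray. The length \<open>2 * \<epsilon> / \<delta>\<close> then yields a subgradient with
      value at least \<open>r i - \<delta> / 2\<close> at \<open>y\<close>, more than the permitted
      \<open>z i y + \<delta>\<close>.\<close>
    have "ereal (a i - \<epsilon> + r i * t) < lsc_hull (f i) (x + t *\<^sub>R y)" if "0 \<le> t" for t
      using no that hx[OF i] \<open>\<epsilon> > 0\<close> by (cases "t = 0") (auto simp: not_le)
    moreover have "2 * \<epsilon> / \<delta> > 0" using \<open>\<epsilon> > 0\<close> \<delta> by simp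
    ultimately obtain \<zeta> where \<zeta>: "\<zeta> \<in> ?D i" "r i - \<epsilon> / (2 * \<epsilon> / \<delta>) \<le> \<zeta> y"
      using eps_subgradient_exists[OF cf[OF i] a[OF i] \<open>\<epsilon> > 0\<close>, of "2 * \<epsilon> / \<delta>" "r i" y] by blast
    have "\<epsilon> / (2 * \<epsilon> / \<delta>) = \<delta> / 2" using \<open>\<epsilon> > 0\<close> \<delta> by simp
    then show False using zmax[OF i \<zeta>(1)] \<zeta>(2) \<delta> by (simp add: r_def)
  qed
  then obtain t where t: "\<And>i. i \<in> I \<Longrightarrow> t i > 0"
    "\<And>i. i \<in> I \<Longrightarrow> lsc_hull (f i) (x + t i *\<^sub>R y) \<le> ereal (a i - \<epsilon> + r i * t i)"
    by metis
  \<comment> \<open>Halving puts \<open>\<tau>\<close> strictly below every \<open>t i\<close>, so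
    that the weight \<open>\<theta>\<close> below is less than 1.\<close>
  define \<tau> where "\<tau> = Min (insert 1 (t ` I)) / 2"
  have "Min (insert 1 (t ` I)) > 0" using I t(1) by (subst Min_gr_iff) auto
  moreover have "Min (insert 1 (t ` I)) \<le> t i" if "i \<in> I" for i using I that by (intro Min_le) auto
  ultimately have \<tau>: "\<tau> > 0" "\<And>i. i \<in> I \<Longrightarrow> \<tau> < t i"
    using t(1) by (fastforce simp: \<tau>_def)+
  \<comment> \<open>Convexity towards \<open>x\<close> transports the bounds from the different
    distances \<open>t i\<close> to the common distance \<open>\<tau>\<close>; the leftover
    \<open>- \<theta> * \<epsilon>\<close> is discarded.\<close>
  have le: "lsc_hull (f i) (x + \<tau> *\<^sub>R y) \<le> ereal (a i + r i * \<tau>)" if i: "i \<in> I" for i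
  proof -
    define \<theta> where "\<theta> = \<tau> / t i"
    have \<theta>: "0 < \<theta>" "\<theta> < 1" "\<theta> * t i = \<tau>" using \<tau> t(1)[OF i] i by (auto simp: \<theta>_def)
    have "lsc_hull (f i) ((1 - \<theta>) *\<^sub>R x + \<theta> *\<^sub>R (x + t i *\<^sub>R y)) \<le> ereal ((1 - \<theta>) * a i + \<theta> * (a i - \<epsilon> + r i * t i))"
      using lsc_hull_segment[OF cf[OF i] a[OF i] \<theta>(1,2) t(2)[OF i]] .
    moreover have "(1 - \<theta>) *\<^sub>R x + \<theta> *\<^sub>R (x + t i *\<^sub>R y) = x + \<tau> *\<^sub>R y"
      by (simp add: algebra_simps flip: \<theta>(3))
    moreover have "(1 - \<theta>) * a i + \<theta> * (a i - \<epsilon> + r i * t i) = a i + r i * \<tau> - \<theta> * \<epsilon>"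
      unfolding \<theta>(3)[symmetric] by (simp add: algebra_simps)
    moreover have "\<theta> * \<epsilon> > 0" using \<theta> \<open>\<epsilon> > 0\<close> by simp
    ultimately show ?thesis by (auto elim: order_trans)
  qed
  have "lsc_hull (f i) (x + \<tau> *\<^sub>R y) < \<infinity>" if "i \<in> I" for i
    using le[OF that] by (rule le_less_trans) simp
  then have "x + \<tau> *\<^sub>R y \<in> (\<Inter>j\<in>I. effective_domain (lsc_hull (f j)))"
    by (simp add: effective_domain_def)
  then have "f i (x + \<tau> *\<^sub>R y) \<le> ereal (a i + r i * \<tau>)" if "i \<in> I" for i
    using hull le that by metis
  then have upper: "(\<Sum>i\<in>I. f i (x + \<tau> *\<^sub>R y)) \<le> (\<Sum>i\<in>I. ereal (a i + r i * \<tau>))"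
    by (rule sum_mono)
  have "ereal (\<phi> (\<tau> *\<^sub>R y) + (\<Sum>i\<in>I. a i)) \<le> (\<Sum>i\<in>I. f i (x + \<tau> *\<^sub>R y))"
    using \<phi>sub[of "x + \<tau> *\<^sub>R y"] a by simp
  also note upper
  also have "(\<Sum>i\<in>I. ereal (a i + r i * \<tau>)) = ereal ((\<Sum>i\<in>I. a i) + (\<Sum>i\<in>I. r i) * \<tau>)"
    by (simp add: sum.distrib sum_distrib_right)
  finally have "\<phi> (\<tau> *\<^sub>R y) \<le> (\<Sum>i\<in>I. r i) * \<tau>" by simp
  moreover have "\<phi> (\<tau> *\<^sub>R y) = \<phi> y * \<tau>"
    using \<phi>d by (simp add: continuous_dual_def linear_scale)
  ultimately have "\<phi> y * \<tau> \<le> (\<Sum>i\<in>I. r i) * \<tau>" by (simp only:)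
  then show False using r \<tau>(1) by simp
qed

section \<open>Conjugates and the infimal convolution\<close>

lemma conjugate_ge:
  assumes "f x = ereal a"
  shows "ereal (\<zeta> x - a) \<le> fenchel_conjugate f \<zeta>"
  unfolding fenchel_conjugate_def using assms by (intro SUP_upper2[of x]) auto

lemma mem_sum_eps_subdifferential_if_infimal_convolution:
  assumes I: "finite I" and a: "\<And>i. i \<in> I \<Longrightarrow> f i x = ereal (a i)"
    and less: "infimal_convolution I (\<lambda>i. fenchel_conjugate (f i)) \<phi> < ereal (\<phi> x - (\<Sum>i\<in>I. a i) + \<eta>)"
  shows "\<phi> \<in> (\<Sum>i\<in>I. eps_subdifferential \<eta> (f i) x)"
proof -
  obtain z where z: "\<And>i. i \<in> I \<Longrightarrow> z i \<in> continuous_dual" "(\<Sum>i\<in>I. z i) = \<phi>"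
    and zless: "(\<Sum>i\<in>I. fenchel_conjugate (f i) (z i)) < ereal (\<phi> x - (\<Sum>i\<in>I. a i) + \<eta>)"
    using less by (auto simp: infimal_convolution_def INF_less_iff)
  have "fenchel_conjugate (f i) (z i) \<le> ereal (z i x - a i + \<eta>)" if i: "i \<in> I" for i
  proof (rule ccontr)
    assume "\<not> ?thesis"
    \<comment> \<open>A gap above \<open>\<eta>\<close> at index \<open>i\<close>, added to the
      nonnegative gaps at the others, contradicts that the total gap is below
      \<open>\<eta>\<close>.\<close>
    then have "ereal (z i x - a i + \<eta>) + (\<Sum>j\<in>I - {i}. ereal (z j x - a j))
        \<le> fenchel_conjugate (f i) (z i) + (\<Sum>j\<in>I - {i}. fenchel_conjugate (f j) (z j))"
      using a by (intro add_mono sum_mono conjugate_ge) auto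
    also have "\<dots> = (\<Sum>j\<in>I. fenchel_conjugate (f j) (z j))"
      using sum.remove[OF I i, of "\<lambda>j. fenchel_conjugate (f j) (z j)"] by simp
    also have "\<dots> < ereal (\<phi> x - (\<Sum>i\<in>I. a i) + \<eta>)" by (rule zless)
    also have "\<phi> x = (\<Sum>j\<in>I. z j x)" using z(2) by (auto simp: sum_fun_apply)
    finally show False
      using sum.remove[OF I i, of "\<lambda>j. z j x"] sum.remove[OF I i, of a] by (simp add: sum_subtractf)
  qed
  then have "\<forall>i\<in>I. z i \<in> eps_subdifferential \<eta> (f i) x"
    using z(1) a by (simp add: eps_subdifferential_iff_conjugate)
  then show ?thesis unfolding mem_sum_sets_iff[OF I] using z(2) by blast
qed

text \<open>Each component of the decomposition contributes a Fenchel-Young gap of at most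
  \<open>\<epsilon>\<close>.\<close>

lemma infimal_convolution_le_if_mem_sum_eps_subdifferential:
  fixes f :: "'i \<Rightarrow> 'a::locally_convex_space \<Rightarrow> ereal"
  assumes I: "finite I" and a: "\<And>i. i \<in> I \<Longrightarrow> f i x = ereal (a i)"
    and \<phi>: "\<phi> \<in> (\<Sum>i\<in>I. eps_subdifferential \<epsilon> (f i) x)"
  shows "infimal_convolution I (\<lambda>i. fenchel_conjugate (f i)) \<phi> \<le> ereal (\<phi> x - (\<Sum>i\<in>I. a i) + real (card I) * \<epsilon>)"
proof -
  obtain z where z: "\<And>i. i \<in> I \<Longrightarrow> z i \<in> eps_subdifferential \<epsilon> (f i) x" "\<phi> = (\<Sum>i\<in>I. z i)"
    using \<phi> unfolding mem_sum_sets_iff[OF I] by blast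
  have zd: "z i \<in> continuous_dual" and le: "fenchel_conjugate (f i) (z i) \<le> ereal (z i x - a i + \<epsilon>)" if "i \<in> I" for i
    using z(1)[OF that] eps_subdifferential_iff_conjugate[of "f i" x "a i"] a[OF that] by auto
  have "infimal_convolution I (\<lambda>i. fenchel_conjugate (f i)) \<phi> \<le> (\<Sum>i\<in>I. fenchel_conjugate (f i) (z i))"
    unfolding infimal_convolution_def using zd z(2) by (intro INF_lower) auto
  also have "\<dots> \<le> (\<Sum>i\<in>I. ereal (z i x - a i + \<epsilon>))" by (intro sum_mono le)
  also have "\<dots> = ereal (\<phi> x - (\<Sum>i\<in>I. a i) + card I * \<epsilon>)"
    by (simp add: z(2) sum_fun_apply sum.distrib sum_subtractf)
  finally show ?thesis .
qed

text \<open>Closed sublevel sets need a constant bound, whereas the bound for \<open>\<psi>\<close>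
  in the sum depends on \<open>\<psi> x\<close>. Restricting to the weak* open set \<open>S\<close>
  around \<open>\<phi>\<close> makes it uniform.\<close>

lemma infimal_convolution_le_if_lower_semicontinuous:
  assumes I: "finite I" and a: "\<And>i. i \<in> I \<Longrightarrow> f i x = ereal (a i)"
    and lsc: "lower_semicontinuous_map weak_star (infimal_convolution I (\<lambda>i. fenchel_conjugate (f i)))"
    and cl: "\<And>\<epsilon>. \<epsilon> > 0 \<Longrightarrow> \<phi> \<in> weak_star closure_of (\<Sum>i\<in>I. eps_subdifferential \<epsilon> (f i) x)"
  shows "infimal_convolution I (\<lambda>i. fenchel_conjugate (f i)) \<phi> \<le> ereal (\<phi> x - (\<Sum>i\<in>I. a i))"
proof (rule ereal_le_epsilon2)
  let ?g = "infimal_convolution I (\<lambda>i. fenchel_conjugate (f i))"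
  fix e :: real assume "0 < e"
  \<comment> \<open>\<open>card I\<close> portions pay for the gaps, one more for the variation of
    \<open>\<psi> x\<close> on \<open>S\<close>.\<close>
  define \<epsilon> where "\<epsilon> = e / (card I + 1)"
  have "(real (card I) + 1) * \<epsilon> = e"
    unfolding \<epsilon>_def by (simp add: add_nonneg_eq_0_iff add.commute)
  then have \<epsilon>: "\<epsilon> > 0" "card I * \<epsilon> + \<epsilon> = e"
    using \<open>0 < e\<close> by (simp add: \<epsilon>_def, simp only: distrib_right mult_1)
  let ?A = "\<Sum>i\<in>I. eps_subdifferential \<epsilon> (f i) x"
  define S where "S = {\<psi> \<in> continuous_dual. \<psi> x < \<phi> x + \<epsilon>}"
  have "continuous_map weak_star euclideanreal (\<lambda>\<psi>. \<psi> x)"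
    unfolding weak_star_def
    by (rule continuous_map_from_subtopology) (rule continuous_map_product_projection[OF UNIV_I])
  from openin_continuous_map_preimage[OF this, of "{..<\<phi> x + \<epsilon>}"]
  have S: "openin weak_star S" by (simp add: S_def)
  have \<phi>d: "\<phi> \<in> continuous_dual"
    using subsetD[OF closure_of_subset_topspace cl[OF \<epsilon>(1)]] by simp
  have "weak_star closure_of (S \<inter> ?A) \<subseteq> {\<psi> \<in> topspace weak_star. ?g \<psi> \<le> ereal (\<phi> x - (\<Sum>i\<in>I. a i) + e)}"
  proof (rule closure_of_minimal)
    show "closedin weak_star {\<psi> \<in> topspace weak_star. ?g \<psi> \<le> ereal (\<phi> x - (\<Sum>i\<in>I. a i) + e)}"
      using lsc by (simp add: lower_semicontinuous_map_def)
    show "S \<inter> ?A \<subseteq> {\<psi> \<in> topspace weak_star. ?g \<psi> \<le> ereal (\<phi> x - (\<Sum>i\<in>I. a i) + e)}"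
    proof safe
      fix \<psi> assume \<psi>: "\<psi> \<in> S" "\<psi> \<in> ?A"
      then show "\<psi> \<in> topspace weak_star" by (simp add: S_def)
      have "?g \<psi> \<le> ereal (\<psi> x - (\<Sum>i\<in>I. a i) + card I * \<epsilon>)"
        using infimal_convolution_le_if_mem_sum_eps_subdifferential[OF I a \<psi>(2)] by simp
      also have "\<dots> \<le> ereal (\<phi> x - (\<Sum>i\<in>I. a i) + e)" using \<psi>(1) \<epsilon>(2) by (simp add: S_def)
      finally show "?g \<psi> \<le> ereal (\<phi> x - (\<Sum>i\<in>I. a i) + e)" .
    qed
  qed
  moreover have "\<phi> \<in> weak_star closure_of (S \<inter> ?A)"
    using subsetD[OF openin_Int_closure_of_subset[OF S]] cl[OF \<epsilon>(1)] \<phi>d \<epsilon>(1) by (simp add: S_def)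
  ultimately show "?g \<phi> \<le> ereal (\<phi> x - (\<Sum>i\<in>I. a i)) + ereal e" by auto
qed

text \<open>Adding the inequalities of the components leaves an error of
  \<open>card I * \<eta>\<close>, which is arbitrarily small.\<close>

lemma Inter_sum_eps_subdifferential_subset:
  assumes I: "finite I"
  shows "(\<Inter>\<eta>\<in>{0<..}. \<Sum>i\<in>I. eps_subdifferential \<eta> (f i) x) \<subseteq> subdifferential (\<lambda>v. \<Sum>i\<in>I. f i v) x"
proof
  fix \<phi> assume \<phi>: "\<phi> \<in> (\<Inter>\<eta>\<in>{0<..}. \<Sum>i\<in>I. eps_subdifferential \<eta> (f i) x)"
  have ex: "\<exists>z. (\<forall>i\<in>I. z i \<in> eps_subdifferential \<eta> (f i) x) \<and> \<phi> = (\<Sum>i\<in>I. z i)" if "\<eta> > 0" for \<eta>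
    using \<phi> that I by (auto simp: mem_sum_sets_iff)
  \<comment> \<open>The parameter 1 only serves to extract finiteness at \<open>x\<close> and
    membership in the dual; the estimate decomposes \<open>\<phi>\<close> anew for each
    error.\<close>
  obtain z where z: "\<forall>i\<in>I. z i \<in> eps_subdifferential 1 (f i) x" "\<phi> = (\<Sum>i\<in>I. z i)"
    using ex[of 1] by auto
  have "\<bar>f i x\<bar> \<noteq> \<infinity>" if "i \<in> I" for i
    using z(1) that by (auto simp: eps_subdifferential_def split: if_splits)
  then have a: "f i x = ereal (real_of_ereal (f i x))" if "i \<in> I" for i
    using that by (simp add: ereal_real)
  define a where "a i = real_of_ereal (f i x)" for i
  note a = a[folded a_def]
  have "\<phi> \<in> continuous_dual"
    using z by (auto simp: eps_subdifferential_def split: if_splits intro!: continuous_dual_sum)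
  moreover have "ereal (\<phi> (v - x)) + (\<Sum>i\<in>I. f i x) \<le> (\<Sum>i\<in>I. f i v)" for v
  proof (rule ereal_le_epsilon2)
    fix e :: real assume "0 < e"
    define \<eta> where "\<eta> = e / (card I + 1)"
    have \<eta>: "\<eta> > 0" "card I * \<eta> \<le> e" using \<open>0 < e\<close> by (auto simp: \<eta>_def field_simps)
    obtain z where z: "\<forall>i\<in>I. z i \<in> eps_subdifferential \<eta> (f i) x" "\<phi> = (\<Sum>i\<in>I. z i)"
      using ex[OF \<eta>(1)] by blast
    have "ereal (\<phi> (v - x)) + (\<Sum>i\<in>I. f i x) = (\<Sum>i\<in>I. ereal (z i (v - x)) + f i x)"
      using a by (simp add: z(2) sum_fun_apply sum.distrib)
    also have "\<dots> \<le> (\<Sum>i\<in>I. f i v + ereal \<eta>)"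
      using z(1) by (intro sum_mono) (auto simp: eps_subdifferential_def split: if_splits)
    also have "\<dots> = (\<Sum>i\<in>I. f i v) + ereal (card I * \<eta>)" by (simp add: sum.distrib)
    also have "\<dots> \<le> (\<Sum>i\<in>I. f i v) + ereal e" using \<eta>(2) by (intro add_left_mono) simp
    finally show "ereal (\<phi> (v - x)) + (\<Sum>i\<in>I. f i x) \<le> (\<Sum>i\<in>I. f i v) + ereal e" .
  qed
  moreover have "\<bar>\<Sum>i\<in>I. f i x\<bar> \<noteq> \<infinity>" using a by simp
  ultimately show "\<phi> \<in> subdifferential (\<lambda>v. \<Sum>i\<in>I. f i v) x"
    by (simp add: eps_subdifferential_def)
qed

theorem corollary3p17:
  fixes m :: nat and f :: "nat \<Rightarrow> 'a::locally_convex_space \<Rightarrow> ereal"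
  assumes "m \<ge> 1"
    and "\<And>i. i \<in> {1..m} \<Longrightarrow> proper_fun (f i)"
    and "\<And>i. i \<in> {1..m} \<Longrightarrow> convex_fun (f i)"
    and "(\<Inter>i\<in>{1..m}. effective_domain (f i)) \<noteq> {}"
    and "\<And>i x. i \<in> {1..m} \<Longrightarrow> x \<in> (\<Inter>j\<in>{1..m}. effective_domain (lsc_hull (f j)))
           \<Longrightarrow> lsc_hull (f i) x = f i x"
    and "(\<exists>K>0. \<forall>x\<in>(\<Inter>i\<in>{1..m}. effective_domain (f i)). \<forall>\<epsilon>>0.
            weak_star closure_of (\<Sum>i\<in>{1..m}. eps_subdifferential \<epsilon> (f i) x)
              \<subseteq> (\<Sum>i\<in>{1..m}. eps_subdifferential (K * \<epsilon>) (f i) x))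
       \<or> (\<forall>\<phi>\<in>continuous_dual.
            fenchel_conjugate (\<lambda>x. \<Sum>i\<in>{1..m}. f i x) \<phi>
              = infimal_convolution {1..m} (\<lambda>i. fenchel_conjugate (f i)) \<phi>)
       \<or> lower_semicontinuous_map weak_star
            (infimal_convolution {1..m} (\<lambda>i. fenchel_conjugate (f i)))
       \<or> (\<forall>x. \<forall>\<epsilon>\<ge>0.
            eps_subdifferential \<epsilon> (\<lambda>x. \<Sum>i\<in>{1..m}. f i x) x
              = (\<Inter>\<eta>\<in>{0<..}. \<Union>e\<in>{e. (\<forall>i\<in>{1..m}. 0 \<le> e i) \<and> (\<Sum>i\<in>{1..m}. e i) = \<epsilon> + \<eta>}.
                   \<Sum>i\<in>{1..m}. eps_subdifferential (e i) (f i) x))"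
  shows "\<forall>x. subdifferential (\<lambda>x. \<Sum>i\<in>{1..m}. f i x) x
           = (\<Inter>\<eta>\<in>{0<..}. \<Sum>i\<in>{1..m}. eps_subdifferential \<eta> (f i) x)"
proof (intro allI equalityI subsetI INT_I)
  fix x \<phi>
  assume "\<phi> \<in> (\<Inter>\<eta>\<in>{0<..}. \<Sum>i\<in>{1..m}. eps_subdifferential \<eta> (f i) x)"
  then show "\<phi> \<in> subdifferential (\<lambda>x. \<Sum>i\<in>{1..m}. f i x) x"
    using Inter_sum_eps_subdifferential_subset by blast
next
  fix x \<phi> and \<eta> :: real
  assume \<phi>: "\<phi> \<in> subdifferential (\<lambda>x. \<Sum>i\<in>{1..m}. f i x) x" and "\<eta> \<in> {0<..}"
  then have \<eta>: "\<eta> > 0" by simp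
  have nm: "f i v \<noteq> - \<infinity>" if "i \<in> {1..m}" for i v
    using assms(2)[OF that] by (auto simp: proper_fun_def)
  \<comment> \<open>Conditions (i) and (iii) draw on this; (ii) and (iv) apply to
    \<open>\<phi>\<close> directly.\<close>
  have cl: "\<phi> \<in> weak_star closure_of (\<Sum>i\<in>{1..m}. eps_subdifferential \<epsilon> (f i) x)" if "\<epsilon> > 0" for \<epsilon>
    using that by (intro subdifferential_sum_subset_closure[OF _ nm assms(3,5) \<phi>]) auto
  have "\<phi> \<in> continuous_dual" "\<bar>\<Sum>i\<in>{1..m}. f i x\<bar> \<noteq> \<infinity>"
    using \<phi> by (auto simp: eps_subdifferential_def split: if_splits)
  then obtain a where a: "\<And>i. i \<in> {1..m} \<Longrightarrow> f i x = ereal (a i)"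
    using finite_sum_ereal_imp_finite[of "{1..m}" "\<lambda>i. f i x"] nm by (metis finite_atLeastAtMost)
  from assms(6) show "\<phi> \<in> (\<Sum>i\<in>{1..m}. eps_subdifferential \<eta> (f i) x)"
  proof (elim disjE exE conjE, goal_cases closure conjugate lsc eps)
    case (closure K)
    have "x \<in> (\<Inter>i\<in>{1..m}. effective_domain (f i))" using a by (auto simp: effective_domain_def)
    \<comment> \<open>Condition (i) is used at \<open>\<eta> / K\<close>, so that the enlarged
      parameter is exactly \<open>\<eta>\<close>.\<close>
    moreover have "\<eta> / K > 0" and "K * (\<eta> / K) = \<eta>" using closure(1) \<eta> by simp_all
    ultimately have "weak_star closure_of (\<Sum>i\<in>{1..m}. eps_subdifferential (\<eta> / K) (f i) x)
        \<subseteq> (\<Sum>i\<in>{1..m}. eps_subdifferential \<eta> (f i) x)"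
      using closure(2) by (metis (no_types))
    then show ?case using cl[OF \<open>\<eta> / K > 0\<close>] by (rule subsetD)
  next
    case conjugate
    \<comment> \<open>A subgradient has no Fenchel-Young gap. The strict slack \<open>\<eta>\<close>
      then makes up for an infimum that may not be attained.\<close>
    have "fenchel_conjugate (\<lambda>x. \<Sum>i\<in>{1..m}. f i x) \<phi> \<le> ereal (\<phi> x - (\<Sum>i\<in>{1..m}. a i))"
      using \<phi> a eps_subdifferential_iff_conjugate[of "\<lambda>x. \<Sum>i\<in>{1..m}. f i x" x "\<Sum>i\<in>{1..m}. a i" \<phi> 0] by simp
    also have "\<dots> < ereal (\<phi> x - (\<Sum>i\<in>{1..m}. a i) + \<eta>)" using \<eta> by simp
    finally show ?case
      using bspec[OF conjugate \<open>\<phi> \<in> continuous_dual\<close>] a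
      by (intro mem_sum_eps_subdifferential_if_infimal_convolution[where a = a]) auto
  next
    case lsc
    have "infimal_convolution {1..m} (\<lambda>i. fenchel_conjugate (f i)) \<phi> \<le> ereal (\<phi> x - (\<Sum>i\<in>{1..m}. a i))"
      using infimal_convolution_le_if_lower_semicontinuous[OF _ a lsc cl] by simp
    also have "\<dots> < ereal (\<phi> x - (\<Sum>i\<in>{1..m}. a i) + \<eta>)" using \<eta> by simp
    finally show ?case
      using a by (intro mem_sum_eps_subdifferential_if_infimal_convolution[where a = a]) auto
  next
    case eps
    then have "\<phi> \<in> (\<Inter>\<eta>\<in>{0<..}. \<Union>e\<in>{e. (\<forall>i\<in>{1..m}. 0 \<le> e i) \<and> (\<Sum>i\<in>{1..m}. e i) = 0 + \<eta>}.
        \<Sum>i\<in>{1..m}. eps_subdifferential (e i) (f i) x)"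
      using \<phi> by simp
    then obtain e where e: "\<forall>i\<in>{1..m}. 0 \<le> e i" "(\<Sum>i\<in>{1..m}. e i) = \<eta>"
      "\<phi> \<in> (\<Sum>i\<in>{1..m}. eps_subdifferential (e i) (f i) x)"
      using \<eta> by force
    \<comment> \<open>Condition (iv) at \<open>\<epsilon> = 0\<close> gives nonnegative parameters
      of sum \<open>\<eta>\<close>, so none exceeds it.\<close>
    have "e i \<le> \<eta>" if "i \<in> {1..m}" for i
      using member_le_sum[of i "{1..m}" e] that e by auto
    then have "(\<Sum>i\<in>{1..m}. eps_subdifferential (e i) (f i) x) \<subseteq> (\<Sum>i\<in>{1..m}. eps_subdifferential \<eta> (f i) x)"
      by (intro sum_sets_mono eps_subdifferential_mono) auto
    then show ?case using e(3) by blast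
  qed
qed

end
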